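(* If $P$ is a chess square, then for all integers $n\geq 0$ the intersection $\lambda^n\overline P\cap K(f)$ is connected.
   Context: Let $\ell\geq 2$ be an even integer. Let $f$ be the real analytic function which near $0$ coincides with the real fixed point of period-doubling renormalization with critical point of degree $\ell$. With $\lambda=-f(f(0))\in(0,1)$, it satisfies the Cvitanović–Feigenbaum equation: $f(z)=-\frac1\lambda f(f(\lambda z))$ near $0$; $f(0)=1$; and $f(z)=F(z^\ell)$, where $F^{-1}$ is defined and univalent on $\mathbb C_\lambda=\mathbb C\setminus(]-\infty,-1/\lambda]\cup[1/\lambda^2,+\infty[)$. Put $\mathcal W=F^{-1}(\mathbb C_\lambda)$, $W=\{z\in\mathbb C: z^\ell\in\mathcal W\}$, $W_+=W\cap\{z: 0<\operatorname{Arg}(z)<\pi/\ell\}$ and $W_-=W\cap\{z: -\pi/\ell<\operatorname{Arg}(z)<0\}$. Then $f:W\to\mathbb C_\lambda$, $f(z)=F(z^\ell)$, is a polynomial-like map of degree $\ell$. $K(f)$ denotes its (filled) Julia set, i.e. the set of points of $W$ all of whose iterates under $f:W\to\mathbb C_\lambda$ stay in $W$ (it has empty interior, so Julia set and filled Julia set coincide). An analytic extension of $f$ is a holomorphic function on a connected open subset of $\mathbb C$ which agrees with $f$ on some nonempty open set. It is known that $f$ has a unique maximal analytic extension $\hat f:\widehat W\to\mathbb C$, i.e. one of which all analytic extensions are restrictions, and that $\widehat W$ is a simply connected open subset of $\mathbb C$. Let $\hat f_\lambda(z)=\hat f(\lambda z)$, defined on $\widehat W/\lambda$; it exchanges $W_+$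 and $W_-$. The chess squares are $W_+$, $W_-$, and their (iterated) preimages by $\hat f_\lambda$, i.e. the connected components of $\hat f_\lambda^{-k}(W_+)$ and $\hat f_\lambda^{-k}(W_-)$, $k\geq 0$. $\overline P$ is the closure of $P$ in $\mathbb C$. The empty set is considered connected. *)

theory Defs
  imports "HOL-Complex_Analysis.Complex_Analysis"
begin

section \<open>Real period-doubling fixed points\<close>

text \<open>Real maps are considered on \<open>[-1, 1]\<close>, with turning point \<open>0\<close> and critical value
  \<open>g 0 = 1\<close>; values outside \<open>[-1, 1]\<close> are irrelevant. The scaling factor is \<open>- g (g 0)\<close>.\<close>

definition real_scaling :: "(real \<Rightarrow> real) \<Rightarrow> real" where
  "real_scaling g = - g (g 0)"

definition unimodal_degree :: "nat \<Rightarrow> (real \<Rightarrow> real) \<Rightarrow> bool" where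
  "unimodal_degree l g \<longleftrightarrow>
     g 0 = 1 \<and> g ` {-1..1} \<subseteq> {-1..1} \<and>
     strict_mono_on {-1..0} g \<and> strict_antimono_on {0..1} g \<and>
     (\<exists>h. h analytic_on (complex_of_real ` {-1..1}) \<and>
          (\<forall>x\<in>{-1..1}. h (complex_of_real x) = complex_of_real (g x)) \<and>
          zorder (\<lambda>z. h z - h 0) 0 = int l)"

definition period_doubling_renormalizable :: "(real \<Rightarrow> real) \<Rightarrow> bool" where
  "period_doubling_renormalizable g \<longleftrightarrow>
     (let a = real_scaling g; J = {-a..a}
      in 0 < a \<and> a < 1 \<and> (g \<circ> g) ` J \<subseteq> J \<and> g ` J \<inter> J = {})"

definition period_doubling_renormalization :: "(real \<Rightarrow> real) \<Rightarrow> real \<Rightarrow> real" where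
  "period_doubling_renormalization g x =
     - (1 / real_scaling g) * g (g (real_scaling g * x))"

definition period_doubling_fixed_point :: "nat \<Rightarrow> (real \<Rightarrow> real) \<Rightarrow> bool" where
  "period_doubling_fixed_point l g \<longleftrightarrow>
     unimodal_degree l g \<and> period_doubling_renormalizable g \<and>
     (\<forall>x\<in>{-1..1}. period_doubling_renormalization g x = g x)"


section \<open>Complex extension\<close>

definition slit_plane :: "real \<Rightarrow> complex set" where
  "slit_plane lam = - (complex_of_real ` ({..- 1 / lam} \<union> {1 / lam\<^sup>2..}))"

text \<open>Here \<open>Finv\<close> stands for the univalent branch of the inverse of \<open>F\<close> on the slit plane, so
  \<open>Finv ` slit_plane lam\<close> is the domain on which \<open>F\<close> is considered.\<close>

definition dom_W :: "nat \<Rightarrow> real \<Rightarrow> (complex \<Rightarrow> complex) \<Rightarrow> complex set" where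
  "dom_W l lam Finv = {z. z ^ l \<in> Finv ` slit_plane lam}"

definition W_plus :: "nat \<Rightarrow> real \<Rightarrow> (complex \<Rightarrow> complex) \<Rightarrow> complex set" where
  "W_plus l lam Finv = dom_W l lam Finv \<inter> {z. 0 < Arg z \<and> Arg z < pi / real l}"

definition W_minus :: "nat \<Rightarrow> real \<Rightarrow> (complex \<Rightarrow> complex) \<Rightarrow> complex set" where
  "W_minus l lam Finv = dom_W l lam Finv \<inter> {z. - pi / real l < Arg z \<and> Arg z < 0}"

text \<open>All functions are total; only the values of \<open>F\<close> on \<open>Finv ` slit_plane lam\<close>, of \<open>Finv\<close> on
  the slit plane, and of \<open>f\<close> on \<open>dom_W l lam Finv\<close> are constrained. The condition that \<open>f 0\<close> lies
  in that domain makes \<open>f (f 0)\<close>, and \<open>f (f (\<lambda>z))\<close> for \<open>z\<close> near \<open>0\<close>, meaningful.\<close>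

definition feigenbaum_extension ::
  "nat \<Rightarrow> (real \<Rightarrow> real) \<Rightarrow> real \<Rightarrow> (complex \<Rightarrow> complex) \<Rightarrow> (complex \<Rightarrow> complex)
    \<Rightarrow> (complex \<Rightarrow> complex) \<Rightarrow> bool" where
  "feigenbaum_extension l g lam F Finv f \<longleftrightarrow>
     Finv holomorphic_on slit_plane lam \<and> inj_on Finv (slit_plane lam) \<and>
     (\<forall>w\<in>slit_plane lam. F (Finv w) = w) \<and> Finv 1 = 0 \<and>
     (\<forall>z\<in>dom_W l lam Finv. f z = F (z ^ l)) \<and>
     (\<forall>\<^sub>F x in nhds (0::real). f (complex_of_real x) = complex_of_real (g x)) \<and>
     f 0 = 1 \<and> f 0 \<in> dom_W l lam Finv \<and>
     0 < lam \<and> lam < 1 \<and> complex_of_real lam = - f (f 0) \<and>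
     (\<forall>\<^sub>F z in nhds (0::complex).
        f z = - (1 / complex_of_real lam) * f (f (complex_of_real lam * z)))"


section \<open>Polynomial-like maps and filled Julia sets\<close>

text \<open>The last condition is the degree: fibres are counted with multiplicity.\<close>

definition polynomial_like ::
  "nat \<Rightarrow> (complex \<Rightarrow> complex) \<Rightarrow> complex set \<Rightarrow> complex set \<Rightarrow> bool" where
  "polynomial_like d f U V \<longleftrightarrow>
     2 \<le> d \<and> open U \<and> open V \<and> U \<noteq> {} \<and> V \<noteq> UNIV \<and>
     simply_connected U \<and> simply_connected V \<and>
     compact (closure U) \<and> closure U \<subseteq> V \<and>
     f holomorphic_on U \<and> f ` U \<subseteq> V \<and>
     (\<forall>C. compact C \<and> C \<subseteq> V \<longrightarrow> compact {z \<in> U. f z \<in> C}) \<and>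
     (\<forall>w\<in>V. (\<Sum>z | z \<in> U \<and> f z = w. zorder (\<lambda>x. f x - w) z) = int d)"

definition filled_julia :: "(complex \<Rightarrow> complex) \<Rightarrow> complex set \<Rightarrow> complex set" where
  "filled_julia f U = {z. \<forall>n. (f ^^ n) z \<in> U}"


section \<open>Maximal analytic extension and chess squares\<close>

definition analytic_extension ::
  "(complex \<Rightarrow> complex) \<Rightarrow> complex set \<Rightarrow> (complex \<Rightarrow> complex) \<Rightarrow> complex set \<Rightarrow> bool" where
  "analytic_extension f U h D \<longleftrightarrow>
     open D \<and> connected D \<and> h holomorphic_on D \<and>
     (\<exists>A. open A \<and> A \<noteq> {} \<and> A \<subseteq> D \<inter> U \<and> (\<forall>z\<in>A. h z = f z))"

definition maximal_analytic_extension ::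
  "(complex \<Rightarrow> complex) \<Rightarrow> complex set \<Rightarrow> (complex \<Rightarrow> complex) \<Rightarrow> complex set \<Rightarrow> bool" where
  "maximal_analytic_extension f U fhat D \<longleftrightarrow>
     analytic_extension f U fhat D \<and>
     (\<forall>h E. analytic_extension f U h E \<longrightarrow> E \<subseteq> D \<and> (\<forall>z\<in>E. h z = fhat z))"

text \<open>The \<open>k\<close>-th preimage of a set under the partial map \<open>z \<mapsto> fhat (\<lambda>z)\<close> with domain \<open>D/\<lambda>\<close>.\<close>

fun iter_preimage ::
  "real \<Rightarrow> (complex \<Rightarrow> complex) \<Rightarrow> complex set \<Rightarrow> nat \<Rightarrow> complex set \<Rightarrow> complex set" where
  "iter_preimage lam fhat D 0 A = A"
| "iter_preimage lam fhat D (Suc k) A =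
     {z. complex_of_real lam * z \<in> D \<and>
         fhat (complex_of_real lam * z) \<in> iter_preimage lam fhat D k A}"

definition chess_square ::
  "nat \<Rightarrow> real \<Rightarrow> (complex \<Rightarrow> complex) \<Rightarrow> (complex \<Rightarrow> complex) \<Rightarrow> complex set \<Rightarrow> complex set \<Rightarrow> bool"
where
  "chess_square l lam Finv fhat D P \<longleftrightarrow>
     (\<exists>k. P \<in> components (iter_preimage lam fhat D k (W_plus l lam Finv)) \<or>
          P \<in> components (iter_preimage lam fhat D k (W_minus l lam Finv)))"

end

theory Submission
  imports Defs
begin

text \<open>
  Let \<open>V\<close> be the slit plane and \<open>K\<close> the filled Julia set. The map \<open>f\<close> is \<open>F\<close> after the power map,
  so every slit closed half-plane carries continuous inverse branches of \<open>f\<close>, and, because \<open>f\<close> is real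
  on the real line, also of its iterates. As \<open>K\<close> is connected and meets the real line in an interval,
  it meets every closed half-plane bounded by that line in a connected set.

  Maximality of the extension gives \<open>fhat (\<lambda>z)\<close> on \<open>W\<close> as an inverse branch of \<open>f\<close> applied
  to \<open>-\<lambda> f z\<close>; hence a chess square that meets \<open>W\<close> is the image of a half-plane under an inverse
  branch of \<open>f\<close>, which settles \<open>n = 0\<close>. For \<open>n = m + 1\<close> and \<open>N = 2 ^ m\<close>, the iterated functional
  equation \<open>f^N z = (-\<lambda>)^m fhat (z / \<lambda>^m)\<close> shows that either \<open>\<lambda>^n P\<close> stays away from \<open>K\<close> or an
  inverse branch of \<open>f^N\<close> maps \<open>(-\<lambda>)^m closure P' \<inter> K\<close> onto \<open>\<lambda>^n closure P \<inter> K\<close>, where \<open>P'\<close> is the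
  square containing \<open>fhat (\<lambda>P)\<close>; and \<open>K = -K\<close>.
\<close>


section \<open>Connected sets, half-planes and roots\<close>

text \<open>In a separation of \<open>A\<close>, the connected set \<open>A \<inter> B\<close> lies
  on one side; enlarging that side by \<open>B\<close> would separate \<open>A \<union> B\<close>.
  This is how connectedness of \<open>K\<close> passes to its halves on either side of the real
  line.\<close>

lemma connected_closed_piece:
  fixes A B :: "'a::topological_space set"
  assumes "closed A" "closed B" "connected (A \<union> B)" "connected (A \<inter> B)"
  shows "connected A"
proof -
  have False
    if e: "closed C" "closed D" "A \<subseteq> C \<union> D" "C \<inter> D \<inter> A = {}" "C \<inter> A \<noteq> {}" "D \<inter> A \<noteq> {}" "A \<inter> B \<subseteq> C" for C D
  proof -
    have "closed ((A \<inter> C) \<union> B)" "closed (A \<inter> D)" using assms e by auto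
    moreover have "A \<union> B \<subseteq> ((A \<inter> C) \<union> B) \<union> (A \<inter> D)" using e by auto
    moreover have "((A \<inter> C) \<union> B) \<inter> (A \<inter> D) \<inter> (A \<union> B) = {}" using e by auto
    moreover have "((A \<inter> C) \<union> B) \<inter> (A \<union> B) \<noteq> {}" using e by auto
    moreover have "(A \<inter> D) \<inter> (A \<union> B) \<noteq> {}" using e by auto
    ultimately show False using assms(3) unfolding connected_closed by blast
  qed
  note key = this
  show ?thesis
    unfolding connected_closed
  proof clarify
    fix C D assume e: "closed C" "closed D" "A \<subseteq> C \<union> D" "C \<inter> D \<inter> A = {}" "C \<inter> A \<noteq> {}" "D \<inter> A \<noteq> {}"
    have "A \<inter> B \<subseteq> C \<or> A \<inter> B \<subseteq> D"
    proof (rule ccontr)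
      assume "\<not> ?thesis"
      then have "C \<inter> (A \<inter> B) \<noteq> {}" "D \<inter> (A \<inter> B) \<noteq> {}" using e by auto
      moreover have "A \<inter> B \<subseteq> C \<union> D" "C \<inter> D \<inter> (A \<inter> B) = {}" using e by auto
      ultimately show False using assms(4) e(1,2) unfolding connected_closed by blast
    qed
    then show False
    proof
      assume "A \<inter> B \<subseteq> C" then show False using key[of C D] e by auto
    next
      assume "A \<inter> B \<subseteq> D" then show False using key[of D C] e by auto
    qed
  qed
qed

lemma open_image_power:
  fixes U :: "complex set"
  assumes "open U" "0 < n"
  shows "open ((\<lambda>z. z ^ n) ` U)"
proof (rule open_mapping_thm[of _ UNIV])
  show "\<not> (\<lambda>z::complex. z ^ n) constant_on UNIV"
  proof
    assume "(\<lambda>z::complex. z ^ n) constant_on UNIV"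
    then have "(0::complex) ^ n = 1 ^ n" unfolding constant_on_def by (metis UNIV_I)
    then show False using assms by (simp add: zero_power)
  qed
qed (use assms in \<open>auto intro!: holomorphic_intros\<close>)

text \<open>Both saturations of a separation of the preimage by the group of roots of unity are open, so
  they separate the image.\<close>

lemma connected_power_preimage:
  fixes M :: "complex set"
  assumes M: "connected M" "0 \<in> M" and n: "0 < n"
  shows "connected {z. z ^ n \<in> M}"
proof -
  have False
    if AB: "open A" "open B" "{z. z ^ n \<in> M} \<subseteq> A \<union> B" "A \<inter> B \<inter> {z. z ^ n \<in> M} = {}"
      "B \<inter> {z. z ^ n \<in> M} \<noteq> {}" "0 \<in> A" for A B
  proof -
    let ?R = "{u::complex. u ^ n = 1}"
    \<comment> \<open>\<open>A2\<close> collects the points whose whole orbit under the roots of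
      unity lies in \<open>A\<close>, \<open>B2\<close> those whose orbit meets \<open>B\<close>.
      With one intersection and one union, the two sets cover the preimage and no orbit over
      \<open>M\<close> meets both.\<close>
    define A2 where "A2 = (\<Inter>u\<in>?R. (\<lambda>z. u * z) -` A)"
    define B2 where "B2 = (\<Union>u\<in>?R. (\<lambda>z. u * z) -` B)"
    have fin: "finite ?R" using finite_roots_unity[of n] n by simp
    have "open A2" unfolding A2_def using fin AB
      by (intro open_INT ballI open_vimage continuous_intros) auto
    then have oA: "open ((\<lambda>z. z ^ n) ` A2)" using n by (rule open_image_power)
    have "open B2" unfolding B2_def using AB
      by (intro open_UN ballI open_vimage continuous_intros) auto
    then have oB: "open ((\<lambda>z. z ^ n) ` B2)" using n by (rule open_image_power)
    have cov: "M \<subseteq> (\<lambda>z. z ^ n) ` A2 \<union> (\<lambda>z. z ^ n) ` B2"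
    proof
      fix w assume w: "w \<in> M"
      obtain z where z: "z ^ n = w" using exists_complex_root n by (metis neq0_conv)
      have "u * z \<in> A \<union> B" if "u \<in> ?R" for u proof -
        have "u * z \<in> {z. z ^ n \<in> M}" using that w z by (simp add: power_mult_distrib)
        then show ?thesis using AB(3) by blast
      qed
      then have "z \<in> A2 \<union> B2" by (auto simp: A2_def B2_def)
      then show "w \<in> (\<lambda>z. z ^ n) ` A2 \<union> (\<lambda>z. z ^ n) ` B2" using z by auto
    qed
    have dis: "(\<lambda>z. z ^ n) ` A2 \<inter> (\<lambda>z. z ^ n) ` B2 \<inter> M = {}"
    proof (rule ccontr)
      assume "\<not> ?thesis"
      then obtain z v where zv: "z \<in> A2" "v \<in> B2" "z ^ n = v ^ n" "z ^ n \<in> M" by fastforce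
      obtain u where u: "u \<in> ?R" "u * v \<in> B" using zv(2) by (auto simp: B2_def)
      obtain t where t: "t \<in> ?R" "u * v = t * z"
      proof (cases "z = 0")
        case True
        then have "v = 0" using zv(3) n by (metis power_eq_0_iff)
        then show ?thesis using that[of 1] True by auto
      next
        case False
        have "(u * v) ^ n = z ^ n" using zv(3) u(1) by (simp only: power_mult_distrib) simp
        then have "(u * v / z) ^ n = 1" using False by (simp only: power_divide) simp
        then show ?thesis using that[of "u * v / z"] False by simp
      qed
      have "t * z \<in> A" using zv(1) t(1) by (auto simp: A2_def)
      moreover have "t * z \<in> B" using t u by simp
      moreover have "t * z \<in> {z. z ^ n \<in> M}" using t(1) zv(4) by (simp add: power_mult_distrib)
      ultimately show False using AB(4) by blast
    qed
    \<comment> \<open>The orbit of 0 is the single point 0, so \<open>0 \<in> A\<close> suffices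
      here. For any other point of \<open>A\<close> the orbit might also meet \<open>B\<close>,
      which is why 0 must belong to \<open>M\<close>.\<close>
    have "0 \<in> A2" using AB(6) by (auto simp: A2_def)
    then have "0 \<in> (\<lambda>z. z ^ n) ` A2" using n by (metis image_eqI zero_power)
    then have neA: "(\<lambda>z. z ^ n) ` A2 \<inter> M \<noteq> {}" using M(2) by auto
    obtain b where b: "b \<in> B" "b ^ n \<in> M" using AB(5) by auto
    then have "b \<in> B2" by (auto simp: B2_def intro!: exI[of _ 1])
    then have neB: "(\<lambda>z. z ^ n) ` B2 \<inter> M \<noteq> {}" using b by auto
    show False using M(1) oA oB cov dis neA neB unfolding connected_def by blast
  qed
  note key = this
  show ?thesis
    unfolding connected_def
  proof clarify
    fix A B assume AB: "open A" "open B" "{z. z ^ n \<in> M} \<subseteq> A \<union> B" "A \<inter> B \<inter> {z. z ^ n \<in> M} = {}"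
      "A \<inter> {z. z ^ n \<in> M} \<noteq> {}" "B \<inter> {z. z ^ n \<in> M} \<noteq> {}"
    have "0 \<in> {z. z ^ n \<in> M}" using M(2) n by (simp add: zero_power)
    then have "0 \<in> A \<or> 0 \<in> B" using AB(3) by blast
    then show False
    proof
      assume "0 \<in> A" then show False using key[of A B] AB by auto
    next
      assume "0 \<in> B" then show False using key[of B A] AB by (auto simp: Int_commute)
    qed
  qed
qed

text \<open>Half-planes are encoded by a nonzero real \<open>s\<close> of which only the sign
  matters, so that the upper and the lower one are treated at once. A connected set that crosses
  from one to the other would contain a point with imaginary part 0.\<close>

lemma connected_nonreal_halfplane:
  assumes "connected X" "X \<inter> \<real> = {}" "x \<in> X" "0 < s * Im x" "y \<in> X"
  shows "0 < s * Im y"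
proof (rule ccontr)
  assume n: "\<not> ?thesis"
  have c: "connected ((\<lambda>z. s * Im z) ` X)"
    by (intro connected_continuous_image continuous_intros assms)
  have "0 \<in> (\<lambda>z. s * Im z) ` X"
    using connectedD_interval[OF c, of "s * Im y" "s * Im x" 0] assms n by auto
  moreover have "s \<noteq> 0" using assms by auto
  ultimately obtain z where "z \<in> X" "Im z = 0" by auto
  then show False using assms(2) by (auto simp: complex_is_Real_iff)
qed

text \<open>Division by \<open>a\<close>, a multiple of the imaginary unit, turns the closed
  half-plane into the right one, where the principal power is continuous even at 0. The constant
  factor in \<open>r\<close> has n-th power \<open>a\<close> and is chosen to give the prescribed
  value at \<open>z ^ n\<close>.\<close>

lemma continuous_root_halfplane:
  assumes "0 < n" "z \<noteq> 0" "s \<noteq> 0" "0 \<le> s * Im (z ^ n)"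
  obtains r :: "complex \<Rightarrow> complex"
  where "continuous_on {u. 0 \<le> s * Im u} r" "\<And>u. r u ^ n = u" "r (z ^ n) = z"
proof -
  define a where "a = \<i> * of_real s"
  define p where "p = (\<lambda>u. (u / a) powr (1 / of_nat n))"
  define r where "r = (\<lambda>u. (z / p (z ^ n)) * p u)"
  have a: "a \<noteq> 0" using assms by (simp add: a_def)
  have pn: "p u ^ n = u / a" for u
  proof (cases "u = 0")
    case False
    have "p u ^ n = exp (of_nat n * ((1 / of_nat n) * ln (u / a)))"
      using False a unfolding p_def by (simp add: powr_def flip: exp_of_nat_mult)
    also have "\<dots> = u / a" using False a assms(1) by simp
    finally show ?thesis .
  qed (use assms in \<open>simp add: p_def\<close>)
  have p0: "p (z ^ n) \<noteq> 0" using pn[of "z ^ n"] assms a by (auto simp: zero_power)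
  have Re: "0 \<le> Re (u / a)" if "0 \<le> s * Im u" for u
  proof -
    have "Re (u / a) = (s * Im u) / s\<^sup>2" using assms(3)
      by (simp add: a_def Re_divide power2_eq_square field_simps)
    then show ?thesis using that by simp
  qed
  have "continuous_on {u. 0 \<le> s * Im u} p"
    unfolding p_def using Re a assms(1)
    by (intro continuous_on_powr_complex continuous_intros) auto
  then have "continuous_on {u. 0 \<le> s * Im u} r"
    unfolding r_def by (intro continuous_intros)
  moreover have "r u ^ n = u" for u
    using assms a p0 unfolding r_def by (simp add: power_mult_distrib power_divide pn)
  moreover have "r (z ^ n) = z" using p0 by (simp add: r_def)
  ultimately show ?thesis using that by blast
qed

lemma connected_open_halfplane: "connected {w. 0 < s * Im w}"
proof -
  have "{w. 0 < s * Im w} = {w. (\<i> * of_real s) \<bullet> w > 0}" by (simp add: inner_complex_def)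
  then show ?thesis using convex_halfspace_gt convex_connected by metis
qed

lemma closure_limit:
  fixes x :: "nat \<Rightarrow> 'a::metric_space"
  assumes "x \<longlonglongrightarrow> a" "\<And>n. x n \<in> S"
  shows "a \<in> closure S"
  using assms unfolding closure_sequential by blast

text \<open>By De Moivre the argument is multiplied by \<open>n\<close> and stays strictly between
  -pi and pi without vanishing. Together with \<open>power_real_of_Arg\<close> this says that the
  rays bounding the sectors of \<open>W_plus\<close> and \<open>W_minus\<close> are exactly where
  the power becomes real.\<close>

lemma power_nonreal:
  assumes "Arg z \<noteq> 0" "\<bar>Arg z\<bar> < pi / real n" "0 < n"
  shows "z ^ n \<notin> \<real>"
proof -
  have z: "z \<noteq> 0" using assms(1) Arg_zero by auto
  have a: "\<bar>real n * Arg z\<bar> < pi" using assms(2,3) by (simp add: abs_mult field_simps)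
  have "sin (real n * Arg z) \<noteq> 0"
  proof (cases "0 < Arg z")
    case True
    then show ?thesis using a assms(3) sin_gt_zero[of "real n * Arg z"] by auto
  next
    case False
    then have "0 < real n * (- Arg z)" using assms by (intro mult_pos_pos) auto
    then show ?thesis using a sin_gt_zero[of "- (real n * Arg z)"] by auto
  qed
  moreover have "z ^ n = rcis (cmod z ^ n) (real n * Arg z)"
    by (metis DeMoivre2 rcis_cmod_Arg)
  ultimately show ?thesis using z by (auto simp: complex_is_Real_iff)
qed

lemma power_real_of_Arg:
  assumes "Arg z = pi / real n \<or> Arg z = - pi / real n \<or> Arg z = 0" "0 < n"
  shows "z ^ n \<in> \<real>"
proof -
  have "z ^ n = rcis (cmod z ^ n) (real n * Arg z)"
    by (metis DeMoivre2 rcis_cmod_Arg)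
  then show ?thesis using assms by (auto simp: complex_is_Real_iff)
qed

section \<open>The renormalization fixed point and its maximal extension\<close>

text \<open>The bound keeps \<open>of_nat n * Ln v\<close> inside the strip of the principal
  logarithm, so it is the logarithm of \<open>v ^ n\<close>.\<close>

lemma powr_inverse_of_power:
  assumes "v \<noteq> 0" "\<bar>of_nat n * Im (Ln v)\<bar> < pi" "0 < n"
  shows "(v ^ n) powr (1 / of_nat n) = (v :: complex)"
proof -
  have "Ln (v ^ n) = of_nat n * Ln v"
    using assms by (intro Ln_unique) (auto simp: exp_of_nat_mult)
  then show ?thesis using assms by (simp add: powr_def)
qed

locale feigenbaum_map =
  fixes l :: nat and g :: "real \<Rightarrow> real" and lam :: real
    and F Finv f fhat :: "complex \<Rightarrow> complex" and What :: "complex set"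
  assumes l_even: "even l" and l_ge_2: "2 \<le> l"
    and ext: "feigenbaum_extension l g lam F Finv f"
    and poly_like: "polynomial_like l f (dom_W l lam Finv) (slit_plane lam)"
    and maximal: "maximal_analytic_extension f (dom_W l lam Finv) fhat What"
begin

section \<open>The domains of \<open>f\<close> and \<open>Finv\<close>\<close>

abbreviation "V \<equiv> slit_plane lam"
abbreviation "W \<equiv> dom_W l lam Finv"
abbreviation "K \<equiv> filled_julia f W"

lemma lam: "0 < lam" "lam < 1"
  and Finv_holo: "Finv holomorphic_on V" and Finv_inj: "inj_on Finv V"
  and F_Finv: "w \<in> V \<Longrightarrow> F (Finv w) = w" and Finv_1: "Finv 1 = 0"
  and f_0: "f 0 = 1" and one_W: "1 \<in> W" and f_1: "f 1 = - of_real lam"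
  and f_near_real: "\<forall>\<^sub>F x in nhds (0::real). f (of_real x) = of_real (g x)"
  and f_equation: "\<forall>\<^sub>F z in nhds (0::complex). f z = - (1 / of_real lam) * f (f (of_real lam * z))"
  and f_eq_F: "z \<in> W \<Longrightarrow> f z = F (z ^ l)"
  using ext unfolding feigenbaum_extension_def by auto

lemma l_pos: "0 < l" using l_ge_2 by simp

lemma open_V: "open V" and simply_connected_V: "simply_connected V" and open_W: "open W"
  and simply_connected_W: "simply_connected W" and compact_closure_W: "compact (closure W)"
  and closure_W: "closure W \<subseteq> V" and f_holo: "f holomorphic_on W"
  using poly_like unfolding polynomial_like_def by simp_all

lemma compact_f_preimage: "compact C \<Longrightarrow> C \<subseteq> V \<Longrightarrow> compact {z \<in> W. f z \<in> C}"
proof -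
  have "\<forall>C. compact C \<and> C \<subseteq> V \<longrightarrow> compact {z \<in> W. f z \<in> C}"
    using poly_like unfolding polynomial_like_def by (elim conjE) assumption
  then show "compact C \<Longrightarrow> C \<subseteq> V \<Longrightarrow> compact {z \<in> W. f z \<in> C}" by blast
qed

lemmas connected_V = simply_connected_imp_connected[OF simply_connected_V]
  and connected_W = simply_connected_imp_connected[OF simply_connected_W]

lemma f_cont: "continuous_on W f"
  using f_holo by (rule holomorphic_on_imp_continuous_on)

lemma Finv_cont: "continuous_on V Finv"
  using Finv_holo by (rule holomorphic_on_imp_continuous_on)

lemma W_subset_V: "W \<subseteq> V"
  using closure_W closure_subset by blast

lemma mem_V: "w \<in> V \<longleftrightarrow> Im w \<noteq> 0 \<or> (- 1 / lam < Re w \<and> Re w < 1 / lam\<^sup>2)"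
proof -
  have "w \<in> complex_of_real ` S \<longleftrightarrow> Im w = 0 \<and> Re w \<in> S" for S
    by (auto simp: complex_eq_iff image_iff)
  then have "w \<in> V \<longleftrightarrow> \<not> (Im w = 0 \<and> Re w \<in> {..- 1 / lam} \<union> {1 / lam\<^sup>2..})"
    unfolding slit_plane_def by (simp only: Compl_iff)
  then show ?thesis by (simp add: not_le)
qed

lemma one_V: "1 \<in> V"
  using one_W W_subset_V by blast

text \<open>Together with \<open>Finv_f\<close>, this replaces the equation \<open>f z = w\<close>
  by \<open>z ^ l = Finv w\<close>, so that fibres of \<open>f\<close> are sets of l-th roots of
  values of a univalent map.\<close>

lemma W_I:
  assumes "w \<in> V" "z ^ l = Finv w"
  shows "z \<in> W" "f z = w"
proof -
  show "z \<in> W" using assms by (auto simp: dom_W_def)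
  then show "f z = w" using assms f_eq_F F_Finv by simp
qed

lemma
  assumes "z \<in> W"
  shows f_in_V: "f z \<in> V" and Finv_f: "Finv (f z) = z ^ l"
proof -
  obtain w where "w \<in> V" "z ^ l = Finv w" using assms by (auto simp: dom_W_def)
  then show "f z \<in> V" "Finv (f z) = z ^ l" using W_I(2)[of w z] by auto
qed

lemma zero_W: "0 \<in> W"
  by (rule W_I(1)[OF one_V]) (use l_pos Finv_1 in \<open>simp add: zero_power\<close>)

lemma
  assumes "z \<in> W"
  shows minus_W: "- z \<in> W" and f_minus: "f (- z) = f z"
  using W_I[OF f_in_V[OF assms], of "- z"] Finv_f[OF assms] l_even by auto

lemma preimage_W: "{z \<in> W. f z \<in> U} = {z. z ^ l \<in> Finv ` (U \<inter> V)}"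
proof -
  have "z \<in> W \<and> f z \<in> U \<longleftrightarrow> z ^ l \<in> Finv ` (U \<inter> V)" for z
  proof
    assume "z \<in> W \<and> f z \<in> U"
    then show "z ^ l \<in> Finv ` (U \<inter> V)" using f_in_V Finv_f by (metis IntI image_eqI)
  next
    assume "z ^ l \<in> Finv ` (U \<inter> V)"
    then show "z \<in> W \<and> f z \<in> U" using W_I by auto
  qed
  then show ?thesis by blast
qed

lemma connected_preimage_W:
  assumes "connected U" "U \<subseteq> V" "1 \<in> U"
  shows "connected {z \<in> W. f z \<in> U}"
proof -
  have "U \<inter> V = U" using assms by auto
  moreover have "connected (Finv ` U)"
    using assms Finv_cont by (intro connected_continuous_image) (auto intro: continuous_on_subset)
  moreover have "0 \<in> Finv ` U" using assms Finv_1 by (metis image_eqI)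
  ultimately show ?thesis
    unfolding preimage_W using connected_power_preimage[OF _ _ l_pos] by simp
qed

section \<open>Symmetry under complex conjugation\<close>

lemma cnj_V: "cnj w \<in> V \<longleftrightarrow> w \<in> V"
  by (simp add: mem_V)

text \<open>For small real \<open>x\<close>, the point \<open>f x\<close> is real and
  \<open>Finv\<close> has there the real value \<open>x ^ l\<close>. These points accumulate at 1,
  so \<open>Finv\<close> and its conjugate agree on all of \<open>V\<close> by the identity
  theorem.\<close>

lemma Finv_cnj:
  assumes "w \<in> V"
  shows "Finv (cnj w) = cnj (Finv w)"
proof -
  define U where "U = {w \<in> V. w \<in> \<real> \<and> Finv w \<in> \<real>}"
  have lim: "1 islimpt U"
    unfolding islimpt_approachable
  proof (intro allI impI)
    fix e :: real assume e: "0 < e"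
    have "isCont f 0" using f_cont open_W zero_W by (simp add: continuous_on_eq_continuous_at)
    then have "((\<lambda>x. f (of_real x)) \<longlongrightarrow> f 0) (at (0::real))"
      by (rule isCont_tendsto_compose) (auto intro!: tendsto_eq_intros)
    then have "\<forall>\<^sub>F x in at (0::real). dist (f (of_real x)) (f 0) < e"
      using e by (rule tendstoD)
    moreover have "\<forall>\<^sub>F x in at (0::real). f (of_real x) = of_real (g x)"
      using f_near_real by (simp add: eventually_at_filter eventually_mono)
    moreover have "((\<lambda>x. complex_of_real x) \<longlongrightarrow> 0) (at (0::real))"
      by (auto intro!: tendsto_eq_intros)
    then have "\<forall>\<^sub>F x in at (0::real). complex_of_real x \<in> W"
      using open_W zero_W by (rule topological_tendstoD)
    moreover have "\<forall>\<^sub>F x in at (0::real). x \<noteq> 0"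
      by (simp add: eventually_at_filter)
    ultimately have "\<forall>\<^sub>F x in at (0::real). dist (f (of_real x)) (f 0) < e \<and>
      f (of_real x) = of_real (g x) \<and> complex_of_real x \<in> W \<and> x \<noteq> 0"
      by eventually_elim auto
    then obtain x :: real where x: "dist (f (of_real x)) (f 0) < e" "f (of_real x) = of_real (g x)"
      "complex_of_real x \<in> W" "x \<noteq> 0"
      using eventually_happens by fastforce
    have "Finv (f (of_real x)) = of_real (x ^ l)" using Finv_f[OF x(3)] by simp
    \<comment> \<open>Otherwise \<open>x ^ l = Finv 1 = 0\<close>. Hence 1 is approached by points
      of \<open>U\<close> other than itself.\<close>
    moreover have "f (of_real x) \<noteq> 1"
      using calculation Finv_1 x(4) by auto
    ultimately show "\<exists>x'\<in>U. x' \<noteq> 1 \<and> dist x' 1 < e"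
      using x f_0 f_in_V[OF x(3)] unfolding U_def
      by (intro bexI[of _ "f (of_real x)"]) auto
  qed
  have img: "cnj ` V = V" using cnj_V by (auto simp: in_image_cnj_iff)
  have "cnj \<circ> Finv \<circ> cnj holomorphic_on V"
    using Finv_holo open_V img by (intro holomorphic_on_compose_cnj_cnj) simp_all
  then have "(\<lambda>w. Finv w - (cnj \<circ> Finv \<circ> cnj) w) holomorphic_on V"
    using Finv_holo by (intro holomorphic_intros)
  from analytic_continuation[OF this open_V connected_V _ one_V lim]
  have "Finv w - (cnj \<circ> Finv \<circ> cnj) w = 0"
    using assms by (auto simp: U_def Reals_cnj_iff)
  then show ?thesis by (simp add: complex_eq_iff)
qed

lemma Finv_real_iff:
  assumes "w \<in> V"
  shows "Finv w \<in> \<real> \<longleftrightarrow> w \<in> \<real>"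
  using Finv_cnj[OF assms] inj_onD[OF Finv_inj, of "cnj w" w] assms cnj_V[of w]
  by (auto simp: Reals_cnj_iff)

lemma f_real_iff:
  assumes "z \<in> W"
  shows "f z \<in> \<real> \<longleftrightarrow> z ^ l \<in> \<real>"
  using Finv_real_iff[OF f_in_V[OF assms]] Finv_f[OF assms] by simp

lemma
  assumes "z \<in> W"
  shows cnj_W: "cnj z \<in> W" and f_cnj: "f (cnj z) = cnj (f z)"
  using W_I[of "cnj (f z)" "cnj z"] f_in_V[OF assms] Finv_f[OF assms] Finv_cnj[OF f_in_V[OF assms]]
  by (auto simp: cnj_V)

text \<open>The solution \<open>u\<close> of \<open>f u = - lam * f z\<close> that is near \<open>1\<close> for \<open>z\<close> near \<open>0\<close>; the functional
  equation identifies it there with \<open>f (lam * z)\<close>.\<close>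

definition scaled_f :: "complex \<Rightarrow> complex" where
  "scaled_f z = Finv (- of_real lam * f z) powr (1 / of_nat l)"

text \<open>Multiplication by \<open>- lam\<close> sends the real trace of \<open>V\<close> into the
  interval from \<open>- 1 / lam\<close> to 1, which stays in \<open>V\<close> and misses the
  critical value. On it \<open>Finv\<close> is real and has no zero, and it is positive at
  \<open>- lam\<close>; so it remains positive, and the principal root in \<open>scaled_f\<close>
  never meets its cut.\<close>

lemma
  assumes "v \<in> V"
  shows neg_scale_V: "- of_real lam * v \<in> V"
    and Finv_neg_scale: "Finv (- of_real lam * v) \<notin> \<real>\<^sub>\<le>\<^sub>0"
proof -
  have *: "- 1 / lam < - lam * Re v \<and> - lam * Re v < 1" if "Im v = 0"
  proof -
    have "- 1 / lam < Re v" "Re v < 1 / lam\<^sup>2" using assms that by (auto simp: mem_V)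
    then have "lam * (- 1 / lam) < lam * Re v" "lam * Re v < lam * (1 / lam\<^sup>2)"
      using lam by (intro mult_strict_left_mono; simp)+
    then show ?thesis using lam by (auto simp: power2_eq_square)
  qed
  have 1: "1 < 1 / lam\<^sup>2" using lam by (simp add: power_less_one_iff)
  show V: "- of_real lam * v \<in> V"
  proof (cases "Im v = 0")
    case True
    then show ?thesis using *[OF True] 1 unfolding mem_V by simp
  next
    case False
    then show ?thesis using lam unfolding mem_V by simp
  qed
  show "Finv (- of_real lam * v) \<notin> \<real>\<^sub>\<le>\<^sub>0"
  proof
    assume neg: "Finv (- of_real lam * v) \<in> \<real>\<^sub>\<le>\<^sub>0"
    then have "- of_real lam * v \<in> \<real>"
      using Finv_real_iff[OF V] nonpos_Reals_subset_Reals by blast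
    then have Im: "Im v = 0" using lam by (simp add: complex_is_Real_iff)
    define x where "x = - lam * Re v"
    have x: "- of_real lam * v = of_real x" using Im by (simp add: x_def complex_eq_iff)
    let ?h = "\<lambda>x. Re (Finv (of_real x))"
    let ?I = "{- 1 / lam <..< 1}"
    have sub: "complex_of_real t \<in> V" if "t \<in> ?I" for t
      using that 1 by (auto simp: mem_V)
    have "continuous_on ?I (\<lambda>x. Finv (of_real x))"
      by (rule continuous_on_compose2[OF Finv_cont])
         (use sub in \<open>auto intro: continuous_on_of_real continuous_on_id\<close>)
    then have c: "connected (?h ` ?I)"
      by (intro connected_continuous_image continuous_on_Re) simp_all
    have "lam * lam < 1 * 1" using lam by (intro mult_strict_mono) auto
    then have ml: "- lam \<in> ?I" using lam by (auto simp: field_simps)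
    \<comment> \<open>The sign is fixed at the point \<open>- lam = f 1\<close>, whose inverse value
      is \<open>1 ^ l\<close>.\<close>
    have "Finv (- of_real lam) = 1" using Finv_f[OF one_W] f_1 by simp
    then have "1 \<in> ?h ` ?I" using ml by (intro image_eqI[of _ _ "- lam"]) auto
    moreover have "x \<in> ?I" using *[OF Im] by (simp add: x_def)
    then have "Re (Finv (of_real x)) \<in> ?h ` ?I" by (rule imageI)
    moreover have "Re (Finv (of_real x)) \<le> 0" using neg x by (simp add: complex_nonpos_Reals_iff)
    ultimately have "0 \<in> ?h ` ?I" using connectedD_interval[OF c, of "Re (Finv (of_real x))" 1 0] by simp
    then obtain t where t: "t \<in> ?I" "?h t = 0" by auto
    have "Finv (of_real t) \<in> \<real>" using Finv_real_iff[OF sub[OF t(1)]] by simp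
    then have "Finv (of_real t) = Finv 1" using t(2) Finv_1 by (simp add: complex_is_Real_iff complex_eq_iff)
    then have "complex_of_real t = 1" using inj_onD[OF Finv_inj _ sub[OF t(1)] one_V] by simp
    then show False using t(1) by simp
  qed
qed

lemma scaled_f_power:
  assumes "z \<in> W"
  shows "scaled_f z ^ l = Finv (- of_real lam * f z)"
proof -
  let ?u = "Finv (- of_real lam * f z)"
  have "?u \<noteq> 0" using Finv_neg_scale[OF f_in_V[OF assms]] by auto
  then show ?thesis using l_pos by (simp add: scaled_f_def powr_def flip: exp_of_nat_mult)
qed

lemma
  assumes "z \<in> W"
  shows scaled_f_W: "scaled_f z \<in> W" and f_scaled_f: "f (scaled_f z) = - of_real lam * f z"
  using W_I[OF neg_scale_V[OF f_in_V[OF assms]] scaled_f_power[OF assms]] by auto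

text \<open>The principal root divides the argument by \<open>l\<close>. Thus
  \<open>scaled_f\<close> takes values in the sector around the positive axis that contains both
  \<open>W_plus\<close> and \<open>W_minus\<close>.\<close>

lemma Arg_scaled_f:
  assumes "z \<in> W"
  shows "- pi / real l < Arg (scaled_f z)" "Arg (scaled_f z) < pi / real l"
proof -
  let ?u = "Finv (- of_real lam * f z)"
  have u: "?u \<notin> \<real>\<^sub>\<le>\<^sub>0" using Finv_neg_scale[OF f_in_V[OF assms]] .
  then have u0: "?u \<noteq> 0" by auto
  have y: "scaled_f z = exp (Ln ?u / of_nat l)" using u0 by (simp add: scaled_f_def powr_def)
  have im: "\<bar>Im (Ln ?u)\<bar> < pi" using u u0 Im_Ln_less_pi[of ?u] mpi_less_Im_Ln[of ?u]
    by auto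
  have "\<bar>Im (Ln ?u)\<bar> / real l < pi / real l" using im l_pos by (simp add: divide_strict_right_mono)
  then have b: "\<bar>Im (Ln ?u) / real l\<bar> < pi / real l" by simp
  have "pi / real l \<le> pi" using l_pos by (simp add: field_simps)
  then have "- pi < Im (Ln ?u) / real l" "Im (Ln ?u) / real l \<le> pi" using b by linarith+
  then have "Ln (scaled_f z) = Ln ?u / of_nat l" by (intro Ln_unique) (simp_all add: y)
  then have "Arg (scaled_f z) = Im (Ln ?u) / real l" using y by (simp add: Arg_eq_Im_Ln)
  then have "\<bar>Arg (scaled_f z)\<bar> < pi / real l" using b by (simp only:)
  then have "- (pi / real l) < Arg (scaled_f z)" "Arg (scaled_f z) < pi / real l" by linarith+
  then show "- pi / real l < Arg (scaled_f z)" "Arg (scaled_f z) < pi / real l" by simp_all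
qed

lemma scaled_f_holo: "scaled_f holomorphic_on W"
  unfolding scaled_f_def
proof (intro holomorphic_on_powr holomorphic_intros)
  have "(Finv \<circ> (\<lambda>z. - of_real lam * f z)) holomorphic_on W"
    by (rule holomorphic_on_compose_gen[OF _ Finv_holo])
       (use f_holo neg_scale_V f_in_V in \<open>auto intro!: holomorphic_intros\<close>)
  then show "(\<lambda>z. Finv (- of_real lam * f z)) holomorphic_on W" by (simp add: o_def)
qed (use Finv_neg_scale f_in_V in auto)

section \<open>Consequences of maximality\<close>

lemma fhat_extends: "analytic_extension f W h E \<Longrightarrow> E \<subseteq> What \<and> (\<forall>z\<in>E. h z = fhat z)"
  and open_What: "open What" and fhat_holo: "fhat holomorphic_on What"
  using maximal unfolding maximal_analytic_extension_def analytic_extension_def by blast+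

lemma W_What: "W \<subseteq> What" and fhat_eq_f: "z \<in> W \<Longrightarrow> fhat z = f z"
proof -
  have "analytic_extension f W f W"
    unfolding analytic_extension_def using open_W connected_W f_holo zero_W
    by (auto intro!: exI[of _ W])
  from fhat_extends[OF this] show "W \<subseteq> What" "z \<in> W \<Longrightarrow> fhat z = f z" by auto
qed

lemma open_scaled: "open U \<Longrightarrow> c \<noteq> 0 \<Longrightarrow> open ((\<lambda>z. c * z) ` (U :: complex set))"
proof -
  assume U: "open U" and c: "c \<noteq> 0"
  have "(\<lambda>z. c * z) ` U = (\<lambda>z. z / c) -` U"
    using c by (force simp: image_iff)
  then show ?thesis using U c by (auto intro!: open_vimage continuous_intros)
qed

text \<open>Near 0 the value \<open>f (lam * z)\<close> is close to 1 and solves the equation that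
  defines \<open>scaled_f z\<close>, hence equals it. So \<open>scaled_f (z / lam)\<close> on the
  rescaled domain \<open>lam W\<close> is an analytic extension of \<open>f\<close>, and maximality
  embeds it in \<open>fhat\<close>.\<close>

lemma
  assumes "z \<in> W"
  shows scaled_W_What: "of_real lam * z \<in> What" and fhat_lam: "fhat (of_real lam * z) = scaled_f z"
proof -
  let ?c = "complex_of_real lam"
  have c0: "?c \<noteq> 0" using lam by simp
  let ?h = "\<lambda>z. scaled_f (z / ?c)"
  let ?E = "(\<lambda>z. ?c * z) ` W"
  have isf: "isCont f 0" using f_cont open_W zero_W by (simp add: continuous_on_eq_continuous_at)
  have t0: "filterlim (\<lambda>z. ?c * z) (nhds 0) (nhds 0)"
    by (auto intro!: tendsto_eq_intros filterlim_ident)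
  have t1: "filterlim (\<lambda>z. f (?c * z)) (nhds 1) (nhds 0)"
    using isCont_tendsto_compose[OF isf t0] f_0 by simp
  have "filterlim (\<lambda>z. of_nat l * Im (Ln (f (?c * z)))) (nhds (of_nat l * Im (Ln 1))) (nhds 0)"
    by (intro tendsto_intros t1) auto
  then have t2: "filterlim (\<lambda>z. \<bar>of_nat l * Im (Ln (f (?c * z)))\<bar>) (nhds 0) (nhds 0)"
    using tendsto_rabs_zero by fastforce
  have "\<forall>\<^sub>F z in nhds 0. z \<in> W" using open_W zero_W eventually_nhds_in_open by blast
  moreover have "\<forall>\<^sub>F z in nhds 0. ?c * z \<in> W" using t0 open_W zero_W by (rule topological_tendstoD)
  \<comment> \<open>Nonvanishing here and the bound on the logarithm below are the hypotheses of
    \<open>powr_inverse_of_power\<close>; they select the root near 1.\<close>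
  moreover have "\<forall>\<^sub>F z in nhds 0. f (?c * z) \<in> W - {0}"
    by (rule topological_tendstoD[OF t1]) (use open_W one_W in \<open>auto intro: open_delete\<close>)
  moreover have "\<forall>\<^sub>F z in nhds 0. \<bar>of_nat l * Im (Ln (f (?c * z)))\<bar> < pi"
    by (rule order_tendstoD(2)[OF t2]) simp
  ultimately have "\<forall>\<^sub>F z in nhds 0. z \<in> W \<and> ?c * z \<in> W \<and> scaled_f z = f (?c * z)"
    using f_equation
  proof eventually_elim
    case (elim z)
    have "- ?c * f z = f (f (?c * z))" using elim(5) c0 by simp
    then have "scaled_f z = (f (?c * z) ^ l) powr (1 / of_nat l)"
      using Finv_f[of "f (?c * z)"] elim(3) by (simp add: scaled_f_def)
    also have "\<dots> = f (?c * z)" using elim l_pos by (intro powr_inverse_of_power) auto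
    finally show ?case using elim by simp
  qed
  then obtain A where A: "open A" "0 \<in> A" "\<And>z. z \<in> A \<Longrightarrow> z \<in> W \<and> ?c * z \<in> W \<and> scaled_f z = f (?c * z)"
    unfolding eventually_nhds by blast
  have "analytic_extension f W ?h ?E"
    unfolding analytic_extension_def
  proof (intro conjI exI[of _ "(\<lambda>z. ?c * z) ` A"])
    show "open ?E" "open ((\<lambda>z. ?c * z) ` A)" using open_W A c0 by (auto intro: open_scaled)
    show "connected ?E" by (intro connected_continuous_image continuous_intros connected_W)
    have "(scaled_f \<circ> (\<lambda>z. z / ?c)) holomorphic_on ?E"
      by (rule holomorphic_on_compose_gen[OF _ scaled_f_holo]) (use c0 in \<open>auto intro!: holomorphic_intros\<close>)
    then show "?h holomorphic_on ?E" by (simp add: o_def)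
  qed (use A c0 in auto)
  from fhat_extends[OF this] have "?c * z \<in> What" "scaled_f (?c * z / ?c) = fhat (?c * z)"
    using assms by blast+
  then show "?c * z \<in> What" "fhat (?c * z) = scaled_f z" using c0 by auto
qed

section \<open>Iterates, the filled Julia set and inverse branches\<close>

text \<open>The natural domain of the N-th iterate of the partial map \<open>f\<close>. Only the
  first \<open>N\<close> points of the orbit, those with index below \<open>N\<close>, must lie in
  \<open>W\<close>; the value of the iterate may leave it.\<close>

definition orbit_dom :: "nat \<Rightarrow> complex set" where
  "orbit_dom N = {z. \<forall>i<N. (f ^^ i) z \<in> W}"

text \<open>The closed half-plane without the two slits: its boundary keeps the real interval
  contained in \<open>V\<close>, so inverse branches can be followed up to real points of
  \<open>K\<close>.\<close>

definition slit_halfplane :: "real \<Rightarrow> complex set" where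
  "slit_halfplane s = V \<inter> {w. 0 \<le> s * Im w}"

lemma orbit_dom_0 [simp]: "orbit_dom 0 = UNIV"
  by (simp add: orbit_dom_def)

lemma orbit_dom_Suc: "orbit_dom (Suc N) = {z \<in> W. f z \<in> orbit_dom N}"
proof (intro set_eqI iffI)
  fix z assume "z \<in> orbit_dom (Suc N)"
  then have z: "i < Suc N \<Longrightarrow> (f ^^ i) z \<in> W" for i by (simp add: orbit_dom_def)
  have "(f ^^ i) (f z) \<in> W" if "i < N" for i
    using z[of "Suc i"] that by (simp add: funpow_swap1)
  then show "z \<in> {z \<in> W. f z \<in> orbit_dom N}" using z[of 0] by (simp add: orbit_dom_def)
next
  fix z assume z: "z \<in> {z \<in> W. f z \<in> orbit_dom N}"
  have "(f ^^ i) z \<in> W" if "i < Suc N" for i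
    using z that by (cases i) (auto simp: orbit_dom_def funpow_swap1)
  then show "z \<in> orbit_dom (Suc N)" by (simp add: orbit_dom_def)
qed

lemma K_eq: "z \<in> K \<longleftrightarrow> (\<forall>N. z \<in> orbit_dom N)"
  unfolding filled_julia_def orbit_dom_def by auto

lemma K_step: "z \<in> K \<longleftrightarrow> z \<in> W \<and> f z \<in> K"
  unfolding K_eq using orbit_dom_Suc by (metis (no_types, lifting) UNIV_I orbit_dom_0 mem_Collect_eq not0_implies_Suc)

lemma K_W: "z \<in> K \<Longrightarrow> z \<in> W"
  using K_step by blast

lemma K_funpow: "z \<in> orbit_dom N \<Longrightarrow> z \<in> K \<longleftrightarrow> (f ^^ N) z \<in> K"
proof (induction N arbitrary: z)
  case (Suc N)
  then show ?case using K_step[of z] by (auto simp: orbit_dom_Suc funpow_swap1)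
qed auto

lemma K_minus: "z \<in> K \<Longrightarrow> - z \<in> K"
  using K_step minus_W f_minus by metis

lemma open_orbit_dom: "open (orbit_dom N)"
proof (induction N)
  case (Suc N)
  have "orbit_dom (Suc N) = W \<inter> f -` orbit_dom N" by (auto simp: orbit_dom_Suc)
  then show ?case using continuous_on_open_vimage[OF open_W] f_cont Suc
    by (metis Int_commute)
qed auto

lemma funpow_holo: "(f ^^ N) holomorphic_on orbit_dom N"
proof (induction N)
  case (Suc N)
  have "((f ^^ N) \<circ> f) holomorphic_on orbit_dom (Suc N)"
    by (rule holomorphic_on_compose_gen[OF _ Suc])
       (auto simp: orbit_dom_Suc intro: holomorphic_on_subset[OF f_holo])
  then show ?case by (simp only: funpow_Suc_right)
qed (auto simp: id_def intro!: holomorphic_intros)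

section \<open>Dynamics on the real line\<close>

lemma f_real:
  assumes "z \<in> W" "z \<in> \<real>"
  shows "f z \<in> \<real>"
  using f_real_iff[OF assms(1)] assms(2) by (simp add: Reals_power)

lemma funpow_real: "z \<in> orbit_dom N \<Longrightarrow> z \<in> \<real> \<Longrightarrow> (f ^^ N) z \<in> \<real>"
proof (induction N arbitrary: z)
  case (Suc N)
  then show ?case using f_real by (auto simp: orbit_dom_Suc funpow_swap1)
qed auto

lemma Finv_ivt:
  assumes V: "of_real a \<in> V" "of_real b \<in> V"
    and c: "Re (Finv (of_real a)) \<le> c" "c \<le> Re (Finv (of_real b))"
  obtains t where "t \<in> closed_segment a b" "of_real t \<in> V" "Finv (of_real t) = of_real c"
proof -
  let ?h = "\<lambda>x. Re (Finv (of_real x))"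
  have sub: "complex_of_real t \<in> V" if "t \<in> closed_segment a b" for t
  proof -
    have "min a b \<le> t" "t \<le> max a b" using that by (auto simp: closed_segment_eq_real_ivl split: if_splits)
    then show ?thesis using V by (simp add: mem_V min_def max_def split: if_splits)
  qed
  have "continuous_on (closed_segment a b) (\<lambda>x. Finv (of_real x))"
    by (rule continuous_on_compose2[OF Finv_cont])
       (use sub in \<open>auto intro: continuous_on_of_real continuous_on_id\<close>)
  then have "connected (?h ` closed_segment a b)"
    by (intro connected_continuous_image continuous_on_Re) simp_all
  then have "c \<in> ?h ` closed_segment a b"
    by (rule connectedD_interval[of _ "?h a" "?h b"]) (use c in auto)
  then obtain t where t: "t \<in> closed_segment a b" "?h t = c" by auto
  have "Finv (of_real t) \<in> \<real>" using Finv_real_iff[OF sub[OF t(1)]] by simp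
  then have "Finv (of_real t) = of_real c" using t(2) by (auto simp: complex_is_Real_iff complex_eq_iff)
  then show ?thesis using that t(1) sub by blast
qed

text \<open>For \<open>x\<close> in the segment, \<open>x ^ l\<close> lies between
  \<open>0 = Finv 1\<close> and \<open>b ^ l = Finv w\<close>. The intermediate value theorem yields
  a real \<open>t\<close> between 1 and \<open>w\<close> with \<open>Finv t = x ^ l\<close>, that is
  \<open>f x = t\<close>; the bounds on \<open>b\<close> and \<open>w\<close> return
  \<open>t\<close> to the segment.\<close>

lemma
  assumes b: "of_real b \<in> W" "f (of_real b) = of_real w" "\<bar>w\<bar> \<le> \<bar>b\<bar>" "1 \<le> \<bar>b\<bar>" and x: "\<bar>x\<bar> \<le> \<bar>b\<bar>"
  shows real_segment_invariant: "of_real x \<in> W \<and> (\<exists>t. f (of_real x) = of_real t \<and> \<bar>t\<bar> \<le> \<bar>b\<bar>)"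
proof -
  have "Finv (of_real w) = of_real (b ^ l)" using Finv_f[OF b(1)] b(2) by simp
  moreover have "0 \<le> x ^ l" "x ^ l \<le> b ^ l"
    using power_mono[OF x, of l] l_even by (auto simp: power_even_abs zero_le_even_power)
  ultimately obtain t where t: "t \<in> closed_segment 1 w" "of_real t \<in> V" "Finv (of_real t) = of_real (x ^ l)"
    using Finv_ivt[of 1 w "x ^ l"] one_V f_in_V[OF b(1)] b(2) Finv_1 by auto
  have "\<bar>t\<bar> \<le> \<bar>b\<bar>" using t(1) b(3,4) by (auto simp: closed_segment_eq_real_ivl split: if_splits)
  then show ?thesis using W_I[OF t(2), of "of_real x"] t(3) by auto
qed

lemma real_segment_K:
  assumes b: "of_real b \<in> W" "f (of_real b) = of_real w" "\<bar>w\<bar> \<le> \<bar>b\<bar>" "1 \<le> \<bar>b\<bar>" and x: "\<bar>x\<bar> \<le> \<bar>b\<bar>"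
  shows "of_real x \<in> K"
proof -
  have "\<forall>x. \<bar>x\<bar> \<le> \<bar>b\<bar> \<longrightarrow> of_real x \<in> orbit_dom N" for N
  proof (induction N)
    case (Suc N)
    then show ?case using real_segment_invariant[OF b] unfolding orbit_dom_Suc by fastforce
  qed simp
  then show ?thesis using x K_eq by blast
qed

lemma
  assumes x: "\<bar>x\<bar> \<le> 1"
  shows unit_segment_K: "of_real x \<in> K"
    and unit_segment_invariant: "of_real x \<in> W \<and> (\<exists>t. f (of_real x) = of_real t \<and> \<bar>t\<bar> \<le> 1)"
  using real_segment_K[of 1 "- lam" x] real_segment_invariant[of 1 "- lam" x] one_W f_1 lam x by auto

lemma one_K: "1 \<in> K" and zero_K: "0 \<in> K"
  using unit_segment_K[of 1] unit_segment_K[of 0] by auto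

text \<open>Each domain is the preimage under \<open>f\<close> of the preceding one, which contains
  the critical value 1 because \<open>1 \<in> K\<close>.\<close>

lemma connected_orbit_dom: "connected (orbit_dom N)"
proof (induction N)
  case (Suc N)
  have "orbit_dom (Suc N) = {z \<in> W. f z \<in> orbit_dom N \<inter> V}" using f_in_V by (auto simp: orbit_dom_Suc)
  moreover have "connected (orbit_dom N \<inter> V)"
  \<comment> \<open>For \<open>N = 0\<close> the domain is the whole plane and is cut down to
    \<open>V\<close>; afterwards it already lies in \<open>W\<close>.\<close>
  proof (cases N)
    case (Suc M)
    then have "orbit_dom N \<inter> V = orbit_dom N" using W_subset_V by (auto simp: orbit_dom_Suc)
    then show ?thesis using \<open>connected (orbit_dom N)\<close> by simp
  qed (simp add: connected_V)
  moreover have "1 \<in> orbit_dom N" using one_K K_eq by blast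
  ultimately show ?case using connected_preimage_W[of "orbit_dom N \<inter> V"] one_V by simp
qed (simp add: convex_connected)

text \<open>The equation is assumed only near 0. The domain of the rescaled second iterate is
  connected, so maximality identifies that iterate with \<open>fhat\<close> throughout, and the
  domain contains the unit segment.\<close>

lemma f_equation_real:
  assumes "\<bar>x\<bar> \<le> 1"
  shows "f (f (of_real lam * of_real x)) = - of_real lam * f (of_real x)"
proof -
  let ?c = "complex_of_real lam"
  have c: "?c \<noteq> 0" using lam by simp
  let ?E = "(\<lambda>z. (1 / ?c) * z) ` orbit_dom 2"
  let ?h = "\<lambda>z. - (1 / ?c) * (f ^^ 2) (?c * z)"
  have E: "z \<in> ?E \<longleftrightarrow> ?c * z \<in> orbit_dom 2" for z
    using c by (auto simp: image_iff intro!: bexI[of _ "?c * z"])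
  have oE: "open ?E" using open_orbit_dom c by (intro open_scaled) auto
  have "0 \<in> ?E" using zero_K K_eq E by simp
  then have "\<forall>\<^sub>F z in nhds 0. z \<in> ?E" using oE eventually_nhds_in_open by blast
  moreover have "\<forall>\<^sub>F z in nhds 0. z \<in> W" using open_W zero_W eventually_nhds_in_open by blast
  ultimately have "\<forall>\<^sub>F z in nhds 0. z \<in> ?E \<and> z \<in> W \<and> f z = - (1 / ?c) * f (f (?c * z))"
    using f_equation by eventually_elim auto
  then obtain A where A: "open A" "0 \<in> A" "\<And>z. z \<in> A \<Longrightarrow> z \<in> ?E \<and> z \<in> W \<and> f z = - (1 / ?c) * f (f (?c * z))"
    unfolding eventually_nhds by blast
  have "analytic_extension f W ?h ?E"
    unfolding analytic_extension_def
  proof (intro conjI exI[of _ A])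
    show "connected ?E" by (intro connected_continuous_image continuous_intros connected_orbit_dom)
    have "((f ^^ 2) \<circ> (\<lambda>z. ?c * z)) holomorphic_on ?E"
      by (rule holomorphic_on_compose_gen[OF _ funpow_holo]) (use E in \<open>auto intro!: holomorphic_intros\<close>)
    then show "?h holomorphic_on ?E" by (auto simp: o_def intro!: holomorphic_intros)
    show "\<forall>z\<in>A. ?h z = f z" using A(3) by (simp add: numeral_2_eq_2)
  qed (use A oE in auto)
  from fhat_extends[OF this] have *: "z \<in> ?E \<Longrightarrow> ?h z = fhat z" for z by blast
  have "\<bar>lam * x\<bar> \<le> 1 * 1" using assms lam unfolding abs_mult by (intro mult_mono) auto
  then have "of_real (lam * x) \<in> K" using unit_segment_K[of "lam * x"] by simp
  then have "?c * of_real x \<in> orbit_dom 2" using K_eq by simp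
  then have "?h (of_real x) = fhat (of_real x)" using E * by blast
  also have "\<dots> = f (of_real x)" using unit_segment_K[OF assms] K_W fhat_eq_f by blast
  finally have "- f (f (?c * of_real x)) = ?c * f (of_real x)"
    using c by (simp add: numeral_2_eq_2 field_simps)
  then show ?thesis by (metis minus_minus mult_minus_left)
qed

lemma unit_segment_funpow:
  assumes "\<bar>x\<bar> \<le> 1"
  shows "\<exists>t. (f ^^ j) (of_real x) = of_real t \<and> \<bar>t\<bar> \<le> 1"
proof (induction j)
  case (Suc j)
  then show ?case using unit_segment_invariant by fastforce
qed (use assms in auto)

text \<open>Evenness of \<open>f\<close> absorbs the minus sign produced by each use of the
  equation. The exponent is written \<open>Suc j\<close> because one application of \<open>f\<close>
  is needed for that: with no iteration the two sides would be \<open>lam * x\<close> and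
  \<open>- lam * x\<close>.\<close>

lemma funpow_double_scaled:
  assumes x: "\<bar>x\<bar> \<le> 1"
  shows "(f ^^ (2 * Suc j)) (of_real lam * of_real x) = - of_real lam * (f ^^ Suc j) (of_real x)"
proof (induction j)
  case 0
  then show ?case using f_equation_real[OF x] by (simp add: numeral_2_eq_2)
next
  case (Suc j)
  obtain t where t: "(f ^^ Suc j) (of_real x) = of_real t" "\<bar>t\<bar> \<le> 1"
    using unit_segment_funpow[OF x, of "Suc j"] by blast
  have "\<bar>lam * t\<bar> \<le> 1 * 1" using t(2) lam unfolding abs_mult by (intro mult_mono) auto
  then have tW: "of_real lam * of_real t \<in> W" using unit_segment_K[of "lam * t"] K_W by simp
  have "(f ^^ (2 * Suc (Suc j))) (of_real lam * of_real x) =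
      f (f ((f ^^ (2 * Suc j)) (of_real lam * of_real x)))" by simp
  also have "\<dots> = f (f (- (of_real lam * of_real t)))" unfolding Suc t(1) by simp
  also have "\<dots> = - of_real lam * f (of_real t)"
    using f_minus[OF tW] f_equation_real[OF t(2)] by simp
  finally show ?case using t(1) by simp
qed

lemma funpow_scaled_real:
  assumes x: "\<bar>x\<bar> \<le> 1"
  shows "(f ^^ (2 ^ m)) (of_real lam ^ m * of_real x) = (- of_real lam) ^ m * f (of_real x)"
proof (induction m)
  case (Suc m)
  have "lam ^ m \<le> 1" using lam by (simp add: power_le_one)
  then have "\<bar>lam ^ m * x\<bar> \<le> 1 * 1" using x lam unfolding abs_mult by (intro mult_mono) auto
  moreover obtain j where "2 ^ m = Suc j" by (metis not0_implies_Suc power_not_zero zero_neq_numeral)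
  ultimately have "(f ^^ (2 * 2 ^ m)) (of_real lam * of_real (lam ^ m * x)) =
      - of_real lam * (f ^^ (2 ^ m)) (of_real (lam ^ m * x))"
    using funpow_double_scaled[of "lam ^ m * x" j] by (simp del: funpow.simps)
  then show ?case using Suc by (simp add: mult.assoc)
qed auto

text \<open>The iterated renormalization equation: it holds on the real segment, and \<open>orbit_dom\<close> is
  connected, so maximality of \<open>fhat\<close> propagates it.\<close>

lemma
  assumes z: "z \<in> orbit_dom (2 ^ m)"
  shows scaled_orbit_dom_What: "z / of_real lam ^ m \<in> What"
    and fhat_scaled: "fhat (z / of_real lam ^ m) = (f ^^ (2 ^ m)) z / (- of_real lam) ^ m"
proof -
  define c where "c = complex_of_real lam ^ m"
  define d where "d = (- complex_of_real lam) ^ m"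
  have c: "c \<noteq> 0" "d \<noteq> 0" using lam by (auto simp: c_def d_def)
  let ?E = "(\<lambda>z. (1 / c) * z) ` orbit_dom (2 ^ m)"
  let ?h = "\<lambda>z. (f ^^ (2 ^ m)) (c * z) / d"
  have E: "z \<in> ?E \<longleftrightarrow> c * z \<in> orbit_dom (2 ^ m)" for z
    using c by (auto simp: image_iff intro!: bexI[of _ "c * z"])
  have oE: "open ?E" using open_orbit_dom c by (intro open_scaled) auto
  have "0 \<in> ?E" using zero_K K_eq E by simp
  then have "0 \<in> ?E \<inter> W" "open (?E \<inter> W)" using oE open_W zero_W by auto
  then obtain r where r: "0 < r" "ball 0 r \<subseteq> ?E \<inter> W" using open_contains_ball by metis
  have "((f ^^ (2 ^ m)) \<circ> (\<lambda>z. c * z)) holomorphic_on ?E"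
    by (rule holomorphic_on_compose_gen[OF _ funpow_holo]) (use E in \<open>auto intro!: holomorphic_intros\<close>)
  then have hol: "?h holomorphic_on ?E" using c by (auto simp: o_def intro!: holomorphic_intros)
  have eq: "?h u = f u" if u: "u \<in> ball 0 r" for u
  proof -
    \<comment> \<open>The bound 1 keeps the points in the segment where
      \<open>funpow_scaled_real\<close> applies, and \<open>r\<close> keeps them in the common
      domain; they accumulate at 0.\<close>
    let ?U = "complex_of_real ` {0<..<min r 1}"
    have "(0::complex) islimpt ?U"
      unfolding islimpt_approachable
    proof (intro allI impI)
      fix e :: real assume "0 < e"
      then have "min (e/2) (min r 1 / 2) \<in> {0<..<min r 1}" "min (e/2) (min r 1 / 2) < e" using r by auto
      then show "\<exists>x'\<in>?U. x' \<noteq> 0 \<and> dist x' 0 < e" by (intro bexI[of _ "of_real (min (e/2) (min r 1 / 2))"]) auto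
    qed
    moreover have "(\<lambda>u. ?h u - f u) holomorphic_on ball 0 r"
      using holomorphic_on_subset[OF hol, of "ball 0 r"] holomorphic_on_subset[OF f_holo, of "ball 0 r"] r
      by (intro holomorphic_on_diff) auto
    moreover have "?h u - f u = 0" if "u \<in> ?U" for u
    proof -
      obtain x where x: "u = of_real x" "\<bar>x\<bar> \<le> 1" using \<open>u \<in> ?U\<close> by auto
      show ?thesis using funpow_scaled_real[OF x(2), of m] c(2) unfolding x(1) c_def d_def by simp
    qed
    moreover have "?U \<subseteq> ball 0 r" by auto
    ultimately have "?h u - f u = 0"
      using u r by (intro analytic_continuation[of "\<lambda>u. ?h u - f u" "ball 0 r" ?U 0 u]) auto
    then show ?thesis by simp
  qed
  have "analytic_extension f W ?h ?E"
    unfolding analytic_extension_def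
  proof (intro conjI exI[of _ "ball 0 r"])
    show "connected ?E" by (intro connected_continuous_image continuous_intros connected_orbit_dom)
  qed (use r oE hol eq in auto)
  from fhat_extends[OF this] have "z / c \<in> What" "?h (z / c) = fhat (z / c)"
    using z c E[of "z / c"] by auto
  then show "z / of_real lam ^ m \<in> What"
    "fhat (z / of_real lam ^ m) = (f ^^ (2 ^ m)) z / (- of_real lam) ^ m"
    using c by (auto simp: c_def d_def)
qed

text \<open>\<open>K\<close> is the intersection of the decreasing sets \<open>B n\<close>, the
  iterated preimages of \<open>closure W\<close>. Properness of \<open>f\<close> makes them compact,
  and they are connected because each contains the critical value 1.\<close>

lemma compact_K: "compact K" and connected_K: "connected K"
proof -
  define B where "B n = ((\<lambda>S. {z \<in> W. f z \<in> S}) ^^ n) (closure W)" for n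
  have B0: "B 0 = closure W" and BS: "B (Suc n) = {z \<in> W. f z \<in> B n}" for n by (simp_all add: B_def)
  have sub: "B n \<subseteq> closure W" for n
    using closure_subset[of W] by (cases n) (auto simp: B0 BS)
  have comp: "compact (B n)" for n
  proof (induction n)
    case (Suc n)
    then show ?case unfolding BS using sub[of n] closure_W by (intro compact_f_preimage) auto
  qed (use B0 compact_closure_W in \<open>simp only:\<close>)
  have KB: "z \<in> K \<Longrightarrow> z \<in> B n" for z n
  proof (induction n arbitrary: z)
    case 0
    then show ?case using K_W closure_subset unfolding B0 by (metis subsetD)
  next
    case (Suc n)
    then show ?case using K_step[of z] by (simp add: BS)
  qed
  then have one: "1 \<in> B n" for n using one_K by simp
  have conn: "connected (B n)" for n
  proof (induction n)
    case 0
    then show ?case using connected_W by (simp add: B0 connected_imp_connected_closure)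
  next
    case (Suc n)
    then show ?case unfolding BS using sub[of n] closure_W one by (intro connected_preimage_W) auto
  qed
  have dec: "B (Suc n) \<subseteq> B n" for n
    by (induction n) (use sub[of 1] in \<open>auto simp: B0 BS\<close>)
  have K: "K = \<Inter> (range B)"
  proof (intro set_eqI iffI)
    fix z assume "z \<in> K"
    then show "z \<in> \<Inter> (range B)" using KB by simp
  next
    fix z assume "z \<in> \<Inter> (range B)"
    then have z: "z \<in> B n" for n by blast
    have "z \<in> B N \<Longrightarrow> z \<in> orbit_dom N" for N
      by (induction N arbitrary: z) (auto simp: BS orbit_dom_Suc)
    then show "z \<in> K" using z K_eq by blast
  qed
  show "connected K"
    unfolding K using comp conn lift_Suc_antimono_le[of B, OF dec] by (intro connected_nest) auto
  show "compact K"
    unfolding K using comp by (intro compact_Inter) auto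
qed

text \<open>Take \<open>b\<close> of largest modulus among the real points of \<open>K\<close>. Its
  image is again a real point of \<open>K\<close>, so its modulus is at most that of
  \<open>b\<close>, and \<open>real_segment_K\<close> fills the whole symmetric segment up to
  \<open>b\<close>.\<close>

lemma connected_K_real: "connected (K \<inter> \<real>)"
proof -
  let ?R = "{x. complex_of_real x \<in> K}"
  have "closed ?R"
    using continuous_closed_vimage[of K complex_of_real] compact_imp_closed[OF compact_K]
    by (simp add: vimage_def)
  moreover have "bounded ?R"
  proof -
    obtain C where "\<And>z. z \<in> K \<Longrightarrow> norm z \<le> C"
      using compact_imp_bounded[OF compact_K] bounded_iff by metis
    then have "norm x \<le> C" if "x \<in> ?R" for x using that by fastforce
    then show ?thesis unfolding bounded_iff by blast
  qed
  ultimately have "compact ?R" by (simp add: compact_eq_bounded_closed)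
  moreover have 1: "1 \<in> ?R" using one_K by simp
  then have "?R \<noteq> {}" by blast
  ultimately obtain b where b: "b \<in> ?R" "\<And>x. x \<in> ?R \<Longrightarrow> \<bar>x\<bar> \<le> \<bar>b\<bar>"
    using continuous_attains_sup[of ?R abs] continuous_on_rabs[OF continuous_on_id] by blast
  have bW: "of_real b \<in> W" using b(1) K_W by simp
  obtain w where w: "f (of_real b) = of_real w" using f_real[OF bW] by (auto elim: Reals_cases)
  have "w \<in> ?R" using b(1) K_step w by (metis mem_Collect_eq)
  then have "of_real x \<in> K" if "\<bar>x\<bar> \<le> \<bar>b\<bar>" for x
    using real_segment_K[OF bW w, of x] b(2) 1 that by fastforce
  moreover have "\<exists>x. z = of_real x \<and> \<bar>x\<bar> \<le> \<bar>b\<bar>" if "z \<in> K \<inter> \<real>" for z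
  proof -
    obtain x where "z = of_real x" using \<open>z \<in> K \<inter> \<real>\<close> by (auto elim: Reals_cases)
    then show ?thesis using b(2)[of x] \<open>z \<in> K \<inter> \<real>\<close> by auto
  qed
  ultimately have "K \<inter> \<real> = complex_of_real ` {- \<bar>b\<bar>..\<bar>b\<bar>}"
    by (intro set_eqI iffI) (fastforce simp: abs_le_iff)+
  moreover have "connected (complex_of_real ` {- \<bar>b\<bar>..\<bar>b\<bar>})"
    by (intro connected_continuous_image continuous_on_of_real continuous_on_id) simp
  ultimately show ?thesis by simp
qed

text \<open>The two closed halves of \<open>K\<close> have the connected union \<open>K\<close> and
  the connected intersection \<open>K \<inter> \<real>\<close>.\<close>

lemma connected_K_halfplane:
  assumes "s \<noteq> 0"
  shows "connected (K \<inter> {w. 0 \<le> s * Im w})"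
proof (rule connected_closed_piece[of _ "K \<inter> {w. s * Im w \<le> 0}"])
  have "closed {w. 0 \<le> s * Im w}" "closed {w. s * Im w \<le> 0}"
    by (intro closed_Collect_le continuous_intros)+
  then show "closed (K \<inter> {w. 0 \<le> s * Im w})" "closed (K \<inter> {w. s * Im w \<le> 0})"
    using compact_imp_closed[OF compact_K] by auto
  have "K \<inter> {w. 0 \<le> s * Im w} \<union> K \<inter> {w. s * Im w \<le> 0} = K" by auto
  then show "connected (K \<inter> {w. 0 \<le> s * Im w} \<union> K \<inter> {w. s * Im w \<le> 0})"
    using connected_K by simp
  have "K \<inter> {w. 0 \<le> s * Im w} \<inter> (K \<inter> {w. s * Im w \<le> 0}) = K \<inter> \<real>"
    using assms by (auto simp: complex_is_Real_iff intro: antisym)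
  then show "connected (K \<inter> {w. 0 \<le> s * Im w} \<inter> (K \<inter> {w. s * Im w \<le> 0}))"
    using connected_K_real by simp
qed

section \<open>Inverse branches of the iterates\<close>

lemma halfplane_subset_V: "0 < s * Im w \<Longrightarrow> w \<in> V"
  by (auto simp: mem_V)

lemma halfplane_approx:
  assumes "w \<in> slit_halfplane s" "s \<noteq> 0"
  obtains x :: "nat \<Rightarrow> complex" where "\<And>n. 0 < s * Im (x n)" "x \<longlonglongrightarrow> w"
    "\<And>n. x n \<in> slit_halfplane s"
proof -
  define x where "x n = w + \<i> * of_real s * of_real (1 / real (Suc n))" for n
  have "0 < s * s" using assms(2) by (metis not_real_square_gt_zero)
  then have "0 < s * s / real (Suc n)" for n by (intro divide_pos_pos) auto
  then have "0 < s * Im w + s * s / real (Suc n)" for n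
    using assms(1) add_nonneg_pos by (auto simp: slit_halfplane_def)
  then have pos: "0 < s * Im (x n)" for n by (simp add: x_def algebra_simps)
  have "(\<lambda>n. 1 / real (Suc n)) \<longlonglongrightarrow> 0" using LIMSEQ_inverse_real_of_nat by (simp add: inverse_eq_divide)
  then have "(\<lambda>n. complex_of_real (1 / real (Suc n))) \<longlonglongrightarrow> of_real 0" by (rule tendsto_of_real)
  then have "x \<longlonglongrightarrow> w + \<i> * of_real s * of_real 0"
    unfolding x_def by (intro tendsto_add[OF tendsto_const tendsto_mult[OF tendsto_const]])
  then show ?thesis using that[of x] pos halfplane_subset_V[OF pos] by (auto simp: slit_halfplane_def less_imp_le)
qed

lemma halfplane_nonneg:
  assumes "continuous_on (slit_halfplane s) h" "\<And>w. 0 < s * Im w \<Longrightarrow> 0 \<le> (h w :: real)"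
    "w \<in> slit_halfplane s" "s \<noteq> 0"
  shows "0 \<le> h w"
proof -
  obtain x where x: "\<And>n. 0 < s * Im (x n)" "x \<longlonglongrightarrow> w" "\<And>n. x n \<in> slit_halfplane s"
    using halfplane_approx[OF assms(3,4)] by blast
  have "(\<lambda>n. h (x n)) \<longlonglongrightarrow> h w"
    using continuous_on_tendsto_compose[OF assms(1) x(2) assms(3)] x(3) by simp
  then show ?thesis using assms(2) x(1) by (intro LIMSEQ_le_const) auto
qed

text \<open>Induction on \<open>N\<close>, prepending one inverse branch of \<open>f\<close> to a
  branch \<phi> of the remaining iterate. Since iterates are real on the real line, \<phi> maps the
  open half-plane into a single half-plane; so does \<open>Finv\<close> afterwards, and a continuous
  l-th root exists there. Continuity extends these inclusions to the boundary.\<close>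

lemma inverse_branch_exists:
  assumes "z0 \<in> orbit_dom N" "0 < s * Im ((f ^^ N) z0)"
  shows "\<exists>\<phi>. continuous_on (slit_halfplane s) \<phi> \<and> \<phi> ((f ^^ N) z0) = z0 \<and>
    (\<forall>w\<in>slit_halfplane s. \<phi> w \<in> V \<and> \<phi> w \<in> orbit_dom N \<and> (f ^^ N) (\<phi> w) = w)"
  using assms
proof (induction N arbitrary: z0)
  case 0
  then show ?case by (intro exI[of _ "\<lambda>w. w"]) (auto simp: slit_halfplane_def)
next
  case (Suc N)
  have s: "s \<noteq> 0" using Suc.prems by auto
  have z0: "z0 \<in> W" "f z0 \<in> orbit_dom N" using Suc.prems by (auto simp: orbit_dom_Suc)
  have z1: "0 < s * Im ((f ^^ N) (f z0))" using Suc.prems by (simp add: funpow_swap1)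
  obtain \<phi> where \<phi>: "continuous_on (slit_halfplane s) \<phi>" "\<phi> ((f ^^ N) (f z0)) = f z0"
    "\<And>w. w \<in> slit_halfplane s \<Longrightarrow> \<phi> w \<in> V \<and> \<phi> w \<in> orbit_dom N \<and> (f ^^ N) (\<phi> w) = w"
    using Suc.IH[OF z0(2) z1] by blast
  have sub: "{w. 0 < s * Im w} \<subseteq> slit_halfplane s"
    using halfplane_subset_V by (auto simp: slit_halfplane_def)
  have conn: "connected (\<phi> ` {w. 0 < s * Im w})"
    using \<phi>(1) sub connected_open_halfplane by (intro connected_continuous_image) (auto intro: continuous_on_subset)
  have nonreal: "\<phi> ` {w. 0 < s * Im w} \<inter> \<real> = {}"
    using \<phi>(3) sub funpow_real by (fastforce simp: complex_is_Real_iff)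
  have mem: "f z0 \<in> \<phi> ` {w. 0 < s * Im w}" using z1 \<phi>(2) by (metis image_eqI mem_Collect_eq)
  \<comment> \<open>The sign of \<open>t\<close>, like that of \<open>u\<close> below, records which
    half-plane contains the point of the given orbit.\<close>
  define t where "t = Im (f z0)"
  have t0: "t \<noteq> 0" using mem nonreal by (auto simp: t_def complex_is_Real_iff)
  then have tt: "0 < t * Im (f z0)" using t_def by (metis not_real_square_gt_zero)
  have \<phi>t: "0 < t * Im (\<phi> w)" if "0 < s * Im w" for w
    using connected_nonreal_halfplane[OF conn nonreal mem tt] that by blast
  have \<phi>_in: "\<phi> w \<in> slit_halfplane t" if "w \<in> slit_halfplane s" for w
  proof -
    have "0 \<le> t * Im (\<phi> w)"
      by (rule halfplane_nonneg[OF _ _ that s])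
         (use \<phi>t \<phi>(1) in \<open>auto intro!: continuous_intros less_imp_le\<close>)
    then show ?thesis using \<phi>(3)[OF that] by (simp add: slit_halfplane_def)
  qed
  have subt: "{w. 0 < t * Im w} \<subseteq> slit_halfplane t"
    using halfplane_subset_V by (auto simp: slit_halfplane_def)
  have contF: "continuous_on (slit_halfplane t) Finv"
    using Finv_cont by (rule continuous_on_subset) (auto simp: slit_halfplane_def)
  have conn: "connected (Finv ` {w. 0 < t * Im w})"
    using contF subt connected_open_halfplane by (intro connected_continuous_image) (auto intro: continuous_on_subset)
  have nonreal: "Finv ` {w. 0 < t * Im w} \<inter> \<real> = {}"
    using Finv_real_iff halfplane_subset_V by (fastforce simp: complex_is_Real_iff)
  have mem: "z0 ^ l \<in> Finv ` {w. 0 < t * Im w}" using Finv_f[OF z0(1)] tt by (metis image_eqI mem_Collect_eq)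
  define u where "u = Im (z0 ^ l)"
  have u0: "u \<noteq> 0" using mem nonreal by (auto simp: u_def complex_is_Real_iff)
  then have uu: "0 < u * Im (z0 ^ l)" using u_def by (metis not_real_square_gt_zero)
  have Finv_pos: "0 < u * Im (Finv w)" if "0 < t * Im w" for w
    using connected_nonreal_halfplane[OF conn nonreal mem uu] that by blast
  have Finv_in: "0 \<le> u * Im (Finv w)" if "w \<in> slit_halfplane t" for w
    by (rule halfplane_nonneg[OF _ _ that t0])
       (use contF Finv_pos in \<open>auto intro!: continuous_intros less_imp_le\<close>)
  have "z0 \<noteq> 0" using u0 l_pos by (auto simp: u_def zero_power)
  then obtain r where r: "continuous_on {v. 0 \<le> u * Im v} r" "\<And>v. r v ^ l = v" "r (z0 ^ l) = z0"
    using continuous_root_halfplane[OF l_pos _ u0] uu by (metis less_imp_le)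
  let ?\<psi> = "\<lambda>w. r (Finv (\<phi> w))"
  have "continuous_on (slit_halfplane s) ?\<psi>"
    by (rule continuous_on_compose2[OF r(1)], rule continuous_on_compose2[OF contF \<phi>(1)])
       (use \<phi>_in Finv_in in auto)
  moreover have "?\<psi> ((f ^^ Suc N) z0) = z0"
    using \<phi>(2) r(3) Finv_f[OF z0(1)] by (simp add: funpow_swap1)
  moreover have "?\<psi> w \<in> V \<and> ?\<psi> w \<in> orbit_dom (Suc N) \<and> (f ^^ Suc N) (?\<psi> w) = w" if "w \<in> slit_halfplane s" for w
  proof -
    have "?\<psi> w \<in> W" "f (?\<psi> w) = \<phi> w" using W_I[of "\<phi> w" "?\<psi> w"] \<phi>(3)[OF that] r(2) by auto
    then show ?thesis using \<phi>(3)[OF that] W_subset_V by (auto simp: orbit_dom_Suc funpow_swap1)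
  qed
  ultimately show ?case by blast
qed

section \<open>Chess squares\<close>

definition quadrant :: "complex set \<Rightarrow> bool" where
  "quadrant Q \<longleftrightarrow> Q = W_plus l lam Finv \<or> Q = W_minus l lam Finv"

text \<open>The reality of \<open>f\<close> marks the possible edges of squares inside
  \<open>W\<close>; a connected set avoiding them lies in a single piece.\<close>

definition tile :: "complex set \<Rightarrow> bool" where
  "tile T \<longleftrightarrow> connected T \<and> T \<subseteq> W \<and> (\<forall>z\<in>T. f z \<notin> \<real>)"

abbreviation "pre Q k \<equiv> iter_preimage lam fhat What k Q"

lemma quadrant_nonreal:
  assumes "quadrant Q" "z \<in> Q"
  shows "z \<in> W" "f z \<notin> \<real>"
proof -
  show W: "z \<in> W" using assms by (auto simp: quadrant_def W_plus_def W_minus_def)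
  have "Arg z \<noteq> 0 \<and> \<bar>Arg z\<bar> < pi / real l"
    using assms by (auto simp: quadrant_def W_plus_def W_minus_def)
  then show "f z \<notin> \<real>" using power_nonreal[OF _ _ l_pos] f_real_iff[OF W] by blast
qed

lemma quadrant_exists:
  assumes "z \<in> W" "f z \<notin> \<real>" "- pi / real l < Arg z" "Arg z < pi / real l"
  shows "\<exists>Q. quadrant Q \<and> z \<in> Q"
proof -
  have "Arg z \<noteq> 0" using power_real_of_Arg[OF _ l_pos] f_real_iff[OF assms(1)] assms(2) by blast
  then have "z \<in> W_plus l lam Finv \<or> z \<in> W_minus l lam Finv"
    unfolding W_plus_def W_minus_def using assms by simp linarith
  then show ?thesis unfolding quadrant_def by blast
qed

text \<open>\<open>Arg\<close> is continuous on \<open>T\<close>, which avoids the real line, and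
  omits 0 and the bounding angles, since \<open>z ^ l\<close> would be real there. Hence it cannot
  leave the interval of angles that defines \<open>Q\<close>.\<close>

lemma tile_in_quadrant:
  assumes T: "tile T" and Q: "quadrant Q" and z0: "z0 \<in> T" "z0 \<in> Q" and z: "z \<in> T"
  shows "z \<in> Q"
proof -
  have TW: "u \<in> W" "u ^ l \<notin> \<real>" if "u \<in> T" for u
    using T that f_real_iff unfolding tile_def by blast+
  then have "u \<notin> \<real>" if "u \<in> T" for u using that Reals_power by blast
  then have "T \<subseteq> - \<real>\<^sub>\<le>\<^sub>0" using nonpos_Reals_subset_Reals by blast
  then have "connected (Arg ` T)"
    using T continuous_on_subset[OF continuous_on_Arg] connected_continuous_image
    unfolding tile_def by blast
  note ivt = connectedD_interval[OF this imageI imageI]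
  have no: "pi / real l \<notin> Arg ` T" "- pi / real l \<notin> Arg ` T" "0 \<notin> Arg ` T"
    using TW(2) power_real_of_Arg[OF _ l_pos] by (metis imageE)+
  consider "Q = W_plus l lam Finv" | "Q = W_minus l lam Finv" using Q by (auto simp: quadrant_def)
  then show ?thesis
  proof cases
    case 1
    then have a: "0 < Arg z0" "Arg z0 < pi / real l" using z0 by (auto simp: W_plus_def)
    have "0 < Arg z" using ivt[OF z z0(1), of 0] a no by force
    moreover have "Arg z < pi / real l" using ivt[OF z0(1) z, of "pi / real l"] a no by force
    ultimately show ?thesis using 1 TW(1)[OF z] by (auto simp: W_plus_def)
  next
    case 2
    then have a: "- pi / real l < Arg z0" "Arg z0 < 0" using z0 by (auto simp: W_minus_def)
    have "- pi / real l < Arg z" using ivt[OF z z0(1), of "- pi / real l"] a no by force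
    moreover have "Arg z < 0" using ivt[OF z0(1) z, of 0] a no by force
    ultimately show ?thesis using 2 TW(1)[OF z] by (auto simp: W_minus_def)
  qed
qed

lemma scaled_nonreal: "(z::complex) \<notin> \<real> \<Longrightarrow> - of_real lam * z \<notin> \<real>"
  using lam by (simp add: complex_is_Real_iff)

lemma tile_scaled_f: "tile T \<Longrightarrow> tile (scaled_f ` T)"
  unfolding tile_def
proof (intro conjI ballI)
  assume T: "connected T \<and> T \<subseteq> W \<and> (\<forall>z\<in>T. f z \<notin> \<real>)"
  then show "connected (scaled_f ` T)"
    using holomorphic_on_imp_continuous_on[OF scaled_f_holo] continuous_on_subset connected_continuous_image
    by blast
  show "scaled_f ` T \<subseteq> W" using T scaled_f_W by blast
  show "f z \<notin> \<real>" if "z \<in> scaled_f ` T" for z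
  proof -
    obtain u where u: "u \<in> T" "z = scaled_f u" using \<open>z \<in> scaled_f ` T\<close> by blast
    then have "f z = - of_real lam * f u" using T f_scaled_f by blast
    then show ?thesis using T u scaled_nonreal by metis
  qed
qed

lemma W_pre_Suc: "z \<in> W \<Longrightarrow> z \<in> pre Q (Suc k) \<longleftrightarrow> scaled_f z \<in> pre Q k"
  using scaled_W_What fhat_lam by simp

text \<open>On \<open>W\<close> the map \<open>fhat (lam * z)\<close> is \<open>scaled_f\<close>,
  which sends tiles to tiles; this reduces each level to the one below.\<close>

lemma tile_in_pre:
  assumes "tile T" "quadrant Q" "z0 \<in> T" "z0 \<in> pre Q k"
  shows "T \<subseteq> pre Q k"
  using assms
proof (induction k arbitrary: T z0)
  case 0
  then show ?case using tile_in_quadrant[of T Q z0] by auto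
next
  case (Suc k)
  have TW: "T \<subseteq> W" using Suc.prems by (auto simp: tile_def)
  then have "scaled_f z0 \<in> pre Q k" using W_pre_Suc[of z0 k Q] Suc.prems by blast
  then have "scaled_f ` T \<subseteq> pre Q k" using Suc.IH[OF tile_scaled_f[OF Suc.prems(1)] Suc.prems(2)] Suc.prems(3) by blast
  then show ?case using W_pre_Suc TW by blast
qed

text \<open>The limit \<open>z\<close> may lie outside \<open>W\<close>, so the statement concerns
  limits of values of \<open>f\<close> instead of \<open>f z\<close>. The points
  \<open>scaled_f (x n)\<close> converge to a point one level lower, and their
  \<open>f\<close>-values are \<open>- lam * f (x n)\<close>; dividing by \<open>- lam\<close>
  preserves being nonreal.\<close>

lemma pre_limit:
  assumes "quadrant Q" "\<And>n. x n \<in> W" "x \<longlonglongrightarrow> z" "z \<in> pre Q k"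
  shows "\<exists>c. c \<notin> \<real> \<and> (\<lambda>n. f (x n)) \<longlonglongrightarrow> c"
  using assms
proof (induction k arbitrary: x z)
  case 0
  then have "z \<in> Q" by simp
  from quadrant_nonreal[OF 0(1) this] show ?case
    using continuous_on_tendsto_compose[OF f_cont 0(3)] 0(2) by auto
next
  case (Suc k)
  have z: "of_real lam * z \<in> What" "fhat (of_real lam * z) \<in> pre Q k" using Suc.prems(4) by auto
  have "(\<lambda>n. of_real lam * x n) \<longlonglongrightarrow> of_real lam * z" using Suc.prems(3) by (intro tendsto_intros)
  then have "(\<lambda>n. fhat (of_real lam * x n)) \<longlonglongrightarrow> fhat (of_real lam * z)"
    by (rule continuous_on_tendsto_compose[OF holomorphic_on_imp_continuous_on[OF fhat_holo] _ z(1)])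
       (use scaled_W_What[OF Suc.prems(2)] in auto)
  then have "(\<lambda>n. scaled_f (x n)) \<longlonglongrightarrow> fhat (of_real lam * z)" using fhat_lam[OF Suc.prems(2)] by simp
  from Suc.IH[OF Suc.prems(1) scaled_f_W[OF Suc.prems(2)] this z(2)]
  obtain c where c: "c \<notin> \<real>" "(\<lambda>n. - of_real lam * f (x n)) \<longlonglongrightarrow> c"
    using f_scaled_f[OF Suc.prems(2)] by auto
  have c0: "- complex_of_real lam \<noteq> 0" using lam by simp
  have "(\<lambda>n. (- of_real lam * f (x n)) / - of_real lam) \<longlonglongrightarrow> c / - of_real lam"
    using c0 by (intro tendsto_divide c(2) tendsto_const)
  then have "(\<lambda>n. f (x n)) \<longlonglongrightarrow> c / - of_real lam" using c0 by simp
  moreover have "c / - of_real lam \<notin> \<real>" using c lam by (simp add: complex_is_Real_iff)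
  ultimately show ?case by blast
qed

lemma pre_nonreal_value:
  assumes "quadrant Q" "z \<in> W" "z \<in> pre Q k"
  shows "f z \<notin> \<real>"
  using pre_limit[OF assms(1), of "\<lambda>_. z" z k] assms LIMSEQ_unique[OF tendsto_const] by auto

section \<open>Squares as images of half-planes\<close>

definition branch :: "nat \<Rightarrow> real \<Rightarrow> (complex \<Rightarrow> complex) \<Rightarrow> bool" where
  "branch N s \<phi> \<longleftrightarrow> s \<noteq> 0 \<and> continuous_on (slit_halfplane s) \<phi> \<and>
    (\<forall>w\<in>slit_halfplane s. \<phi> w \<in> orbit_dom N \<and> (f ^^ N) (\<phi> w) = w)"

lemma branchE:
  assumes "z \<in> orbit_dom N" "(f ^^ N) z \<notin> \<real>"
  obtains s \<phi> where "branch N s \<phi>" "0 < s * Im ((f ^^ N) z)" "\<phi> ((f ^^ N) z) = z"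
proof -
  define s where "s = Im ((f ^^ N) z)"
  have s: "s \<noteq> 0" using assms(2) by (simp add: s_def complex_is_Real_iff)
  then have "0 < s * Im ((f ^^ N) z)" using s_def by (metis not_real_square_gt_zero)
  with inverse_branch_exists[OF assms(1) this] s show ?thesis using that unfolding branch_def by blast
qed

lemma open_halfplane_slit: "0 < s * Im w \<Longrightarrow> w \<in> slit_halfplane s"
  using halfplane_subset_V by (auto simp: slit_halfplane_def)

lemma
  assumes "branch N s \<phi>"
  shows branch_open: "open (\<phi> ` {w. 0 < s * Im w})"
    and branch_connected: "connected (\<phi> ` {w. 0 < s * Im w})"
proof -
  have sub: "{w. 0 < s * Im w} \<subseteq> slit_halfplane s" using open_halfplane_slit by blast
  then have c: "continuous_on {w. 0 < s * Im w} \<phi>"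
    using assms continuous_on_subset unfolding branch_def by blast
  show "connected (\<phi> ` {w. 0 < s * Im w})"
    using c connected_open_halfplane by (rule connected_continuous_image)
  have "inj_on \<phi> {w. 0 < s * Im w}"
    using assms sub unfolding branch_def by (intro inj_on_inverseI[where g = "f ^^ N"]) blast
  moreover have "open {w. 0 < s * Im w}" by (intro open_Collect_less continuous_intros)
  ultimately show "open (\<phi> ` {w. 0 < s * Im w})" using c by (intro invariance_of_domain)
qed

lemma branch_tendsto:
  assumes "branch N s \<phi>" "\<And>n. w n \<in> slit_halfplane s" "w \<longlonglongrightarrow> a" "a \<in> V"
  shows "a \<in> slit_halfplane s" "(\<lambda>n. \<phi> (w n)) \<longlonglongrightarrow> \<phi> a"
proof -
  have "(\<lambda>n. s * Im (w n)) \<longlonglongrightarrow> s * Im a" using assms(3) by (intro tendsto_intros)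
  moreover have "0 \<le> s * Im (w n)" for n using assms(2) by (auto simp: slit_halfplane_def)
  ultimately have "0 \<le> s * Im a" by (intro LIMSEQ_le_const) auto
  then show a: "a \<in> slit_halfplane s" using assms(4) by (simp add: slit_halfplane_def)
  show "(\<lambda>n. \<phi> (w n)) \<longlonglongrightarrow> \<phi> a"
    using assms(1) unfolding branch_def
    by (intro continuous_on_tendsto_compose[OF _ assms(3) a]) (use assms(2) in auto)
qed

text \<open>The image of the open half-plane is open by invariance of domain, and the last
  hypothesis makes its trace on \<open>X\<close> closed in \<open>X\<close>. A nonempty clopen part
  of a connected set is everything.\<close>

lemma branch_absorbs:
  assumes "branch N s \<phi>" "connected X" "x0 \<in> X" "x0 \<in> \<phi> ` {w. 0 < s * Im w}"
    and closed: "\<And>w x. (\<And>n. 0 < s * Im (w n)) \<Longrightarrow> (\<lambda>n. \<phi> (w n)) \<longlonglongrightarrow> x \<Longrightarrow> x \<in> X \<Longrightarrow>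
      x \<in> \<phi> ` {w. 0 < s * Im w}"
  shows "X \<subseteq> \<phi> ` {w. 0 < s * Im w}"
proof -
  let ?T = "\<phi> ` {w. 0 < s * Im w}"
  have "openin (top_of_set X) (X \<inter> ?T)" using branch_open[OF assms(1)] by (rule openin_open_Int)
  moreover have "X \<inter> ?T = X \<inter> closure ?T"
  proof -
    have "x \<in> ?T" if "x \<in> X" "x \<in> closure ?T" for x
    proof -
      obtain t where t: "\<And>n. t n \<in> ?T" "t \<longlonglongrightarrow> x" using \<open>x \<in> closure ?T\<close> closure_sequential by metis
      then have "\<forall>n. \<exists>w. 0 < s * Im w \<and> t n = \<phi> w" by blast
      then obtain w where w: "\<And>n. 0 < s * Im (w n)" "\<And>n. t n = \<phi> (w n)" by metis
      then show ?thesis using closed[of w x] t(2) that by (simp flip: w(2))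
    qed
    moreover have "?T \<subseteq> closure ?T" by (rule closure_subset)
    ultimately show ?thesis by (intro set_eqI iffI) (simp_all add: subset_iff)
  qed
  then have "closedin (top_of_set X) (X \<inter> ?T)" by (simp add: closedin_closed_Int)
  ultimately have "X \<inter> ?T = {} \<or> X \<inter> ?T = X" using assms(2) unfolding connected_clopen by blast
  then show ?thesis using assms(3,4) by blast
qed

text \<open>The branch image is a tile, hence contained in \<open>pre Q k\<close> and in
  \<open>P\<close>. Conversely, if \<phi> of \<open>w n\<close> tends to a point of
  \<open>P\<close>, then \<open>pre_limit\<close> makes \<open>w\<close> converge to a nonreal
  point, which therefore lies in the open half-plane, and the image absorbs
  \<open>P\<close>.\<close>

lemma component_eq_branch_image:
  assumes Q: "quadrant Q" and P: "P \<in> components (pre Q k)" "z0 \<in> P" and b: "branch 1 s \<phi>"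
    and z0: "0 < s * Im (f z0)" "\<phi> (f z0) = z0"
  shows "P = \<phi> ` {w. 0 < s * Im w}"
proof
  let ?T = "\<phi> ` {w. 0 < s * Im w}"
  have z0T: "z0 \<in> ?T" using z0 by (metis image_eqI mem_Collect_eq)
  have inv: "\<phi> w \<in> W \<and> f (\<phi> w) = w" if "w \<in> slit_halfplane s" for w
    using b that by (auto simp: branch_def orbit_dom_def)
  have "tile ?T"
    unfolding tile_def using branch_connected[OF b] inv open_halfplane_slit
    by (auto simp: complex_is_Real_iff)
  moreover have "z0 \<in> pre Q k" using P in_components_subset by blast
  ultimately have "?T \<subseteq> pre Q k" using tile_in_pre Q z0T by blast
  then show "?T \<subseteq> P"
    using components_maximal[OF P(1) branch_connected[OF b]] z0T P(2) by blast
  show "P \<subseteq> ?T"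
  proof (rule branch_absorbs[OF b in_components_connected[OF P(1)] P(2) z0T])
    fix w x assume w: "\<And>n. 0 < s * Im (w n)" "(\<lambda>n. \<phi> (w n)) \<longlonglongrightarrow> x" "x \<in> P"
    have ws: "w n \<in> slit_halfplane s" for n using w(1) open_halfplane_slit by blast
    have "x \<in> pre Q k" using w(3) P in_components_subset by blast
    then obtain c where c: "c \<notin> \<real>" "(\<lambda>n. f (\<phi> (w n))) \<longlonglongrightarrow> c"
      using pre_limit[OF Q _ w(2)] inv[OF ws] by blast
    then have wc: "w \<longlonglongrightarrow> c" using inv[OF ws] by simp
    have "c \<in> V" using c(1) by (auto simp: mem_V complex_is_Real_iff)
    note lim = branch_tendsto[OF b ws wc this]
    have "x = \<phi> c" using LIMSEQ_unique[OF w(2) lim(2)] .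
    moreover have "s * Im c \<noteq> 0" using c(1) b by (auto simp: complex_is_Real_iff branch_def)
    then have "0 < s * Im c" using lim(1) by (simp add: slit_halfplane_def order_less_le)
    ultimately show "x \<in> ?T" by blast
  qed
qed

lemma orbit_dom_1: "z \<in> orbit_dom 1 \<longleftrightarrow> z \<in> W"
  by (simp add: orbit_dom_def)

text \<open>If \<open>closure P\<close> meets \<open>K\<close>, it meets the open set
  \<open>W\<close>, and so does \<open>P\<close>. The set in question is then the image of the
  closed half of \<open>K\<close> under a branch continuous up to the boundary.\<close>

lemma connected_closure_square_K:
  assumes Q: "quadrant Q" and P: "P \<in> components (pre Q k)"
  shows "connected (closure P \<inter> K)"
proof (cases "closure P \<inter> K = {}")
  case False
  then obtain z where "z \<in> closure P" "z \<in> W" using K_W by blast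
  then have "P \<inter> W \<noteq> {}" using open_W open_Int_closure_eq_empty by blast
  then obtain z0 where z0: "z0 \<in> P" "z0 \<in> W" by blast
  then have "f z0 \<notin> \<real>" using pre_nonreal_value[OF Q] in_components_subset[OF P] by blast
  then obtain s \<phi> where b: "branch 1 s \<phi>" "0 < s * Im (f z0)" "\<phi> (f z0) = z0"
    using branchE[of z0 1] z0 orbit_dom_1 by auto
  have PT: "P = \<phi> ` {w. 0 < s * Im w}" using component_eq_branch_image[OF Q P z0(1) b] .
  have inv: "\<phi> w \<in> W \<and> f (\<phi> w) = w" if "w \<in> slit_halfplane s" for w
    using b that by (auto simp: branch_def orbit_dom_def)
  have s: "s \<noteq> 0" using b(1) by (simp add: branch_def)
  have KV: "K \<subseteq> V" using K_W W_subset_V by blast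
  have "closure P \<inter> K = \<phi> ` (K \<inter> {w. 0 \<le> s * Im w})"
  proof (intro set_eqI iffI)
    fix z assume z: "z \<in> closure P \<inter> K"
    then obtain t where t: "\<And>n. t n \<in> P" "t \<longlonglongrightarrow> z" using closure_sequential by (metis IntD1)
    have t': "f (t n) \<in> slit_halfplane s" "\<phi> (f (t n)) = t n" "t n \<in> W" for n
      using t(1)[of n] inv open_halfplane_slit unfolding PT by auto
    have zK: "z \<in> W" "f z \<in> K" using z K_step by blast+
    have ft: "(\<lambda>n. f (t n)) \<longlonglongrightarrow> f z"
      using continuous_on_tendsto_compose[OF f_cont t(2) zK(1)] t'(3) by simp
    have "f z \<in> V" using zK KV by blast
    note lim = branch_tendsto[OF b(1) t'(1) ft this]
    have "\<phi> (f z) = z" using LIMSEQ_unique[OF lim(2), of z] t(2) t'(2) by simp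
    then show "z \<in> \<phi> ` (K \<inter> {w. 0 \<le> s * Im w})"
      using lim(1) zK(2) by (metis (no_types, lifting) IntD2 IntI image_eqI slit_halfplane_def)
  next
    fix z assume "z \<in> \<phi> ` (K \<inter> {w. 0 \<le> s * Im w})"
    then obtain w where w: "w \<in> K" "w \<in> slit_halfplane s" "z = \<phi> w"
      using KV by (auto simp: slit_halfplane_def)
    obtain x where x: "\<And>n. 0 < s * Im (x n)" "x \<longlonglongrightarrow> w" "\<And>n. x n \<in> slit_halfplane s"
      using halfplane_approx[OF w(2) s] by blast
    have "(\<lambda>n. \<phi> (x n)) \<longlonglongrightarrow> z" using branch_tendsto[OF b(1) x(3) x(2)] w KV by blast
    then have "z \<in> closure P" by (rule closure_limit) (use x(1) PT in blast)
    moreover have "z \<in> K" using K_step inv[OF w(2)] w by metis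
    ultimately show "z \<in> closure P \<inter> K" by blast
  qed
  moreover have "K \<inter> {w. 0 \<le> s * Im w} \<subseteq> slit_halfplane s" using KV by (auto simp: slit_halfplane_def)
  then have "continuous_on (K \<inter> {w. 0 \<le> s * Im w}) \<phi>"
    using b(1) continuous_on_subset unfolding branch_def by blast
  ultimately show ?thesis
    using connected_continuous_image connected_K_halfplane[OF s] by simp
qed simp

text \<open>The conjugate of \<open>fhat\<close> also extends \<open>f\<close>, so maximality makes
  \<open>fhat\<close> commute with conjugation.\<close>

lemma fhat_real:
  assumes "z \<in> What" "z \<in> \<real>"
  shows "fhat z \<in> \<real>"
proof -
  have oc: "open (cnj ` What)"
    unfolding image_cnj_conv_vimage_cnj using open_What by (intro open_vimage continuous_intros) auto
  have cc: "cnj ` cnj ` What = What" by (simp add: image_image)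
  have "analytic_extension f W (cnj \<circ> fhat \<circ> cnj) (cnj ` What)"
    unfolding analytic_extension_def
  proof (intro conjI exI[of _ W])
    have "connected What"
      using maximal unfolding maximal_analytic_extension_def analytic_extension_def by blast
    then show "connected (cnj ` What)" by (intro connected_continuous_image continuous_intros)
    show "cnj \<circ> fhat \<circ> cnj holomorphic_on cnj ` What"
      using fhat_holo cc oc by (intro holomorphic_on_compose_cnj_cnj) simp_all
    show "W \<subseteq> cnj ` What \<inter> W"
    proof
      fix u assume u: "u \<in> W"
      then have "cnj u \<in> What" using cnj_W W_What by blast
      then show "u \<in> cnj ` What \<inter> W" using u in_image_cnj_iff by blast
    qed
    show "\<forall>u\<in>W. (cnj \<circ> fhat \<circ> cnj) u = f u" using fhat_eq_f cnj_W f_cnj by simp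
  qed (use oc open_W zero_W in auto)
  from fhat_extends[OF this] have "(cnj \<circ> fhat \<circ> cnj) z = fhat z"
    using assms by (metis Reals_cnj_iff in_image_cnj_iff)
  then show ?thesis using assms by (simp add: Reals_cnj_iff)
qed

lemma pre_nonreal:
  assumes "quadrant Q" "z \<in> pre Q k"
  shows "z \<notin> \<real>"
  using assms(2)
proof (induction k arbitrary: z)
  case 0
  then show ?case using quadrant_nonreal[OF assms(1)] f_real by auto
next
  case (Suc k)
  then have "of_real lam * z \<in> What" "fhat (of_real lam * z) \<notin> \<real>" by auto
  then have "of_real lam * z \<notin> \<real>" using fhat_real by blast
  then show ?case by (auto intro: Reals_mult)
qed

text \<open>A square of level 0 is also a square of level 1, so the induction below may always apply
  \<open>fhat (lam * z)\<close> at least once.\<close>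

lemma square_level_Suc:
  assumes Q: "quadrant Q" and P: "P \<in> components (pre Q k)"
  obtains Q' k' where "quadrant Q'" "P \<in> components (pre Q' (Suc k'))"
proof (cases k)
  case 0
  obtain z0 where z0: "z0 \<in> P" using P in_components_nonempty by blast
  then have "z0 \<in> Q" using P 0 in_components_subset by fastforce
  note z0' = quadrant_nonreal[OF Q this]
  obtain s \<phi> where b: "branch 1 s \<phi>" "0 < s * Im (f z0)" "\<phi> (f z0) = z0"
    using branchE[of z0 1] z0' orbit_dom_1 by auto
  have "f (scaled_f z0) \<notin> \<real>" using f_scaled_f[OF z0'(1)] scaled_nonreal[OF z0'(2)] by simp
  then obtain Q' where Q': "quadrant Q'" "scaled_f z0 \<in> Q'"
    using quadrant_exists scaled_f_W[OF z0'(1)] Arg_scaled_f[OF z0'(1)] by blast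
  then have "z0 \<in> pre Q' 1" using W_pre_Suc[OF z0'(1), of 0 Q'] by simp
  then obtain P' where P': "P' \<in> components (pre Q' 1)" "z0 \<in> P'"
    using Union_components by (metis UnionE)
  \<comment> \<open>Both squares contain \<open>z0\<close> and equal the image of the same
    half-plane under the same branch.\<close>
  have "P' = P"
    using component_eq_branch_image[OF Q' (1) P' b] component_eq_branch_image[OF Q P z0 b] by simp
  then show ?thesis using that[OF Q'(1), of 0] P' by simp
next
  case (Suc k')
  then show ?thesis using that Q P by blast
qed

text \<open>The square is kept arbitrary in the induction on \<open>n\<close>, since the step passes
  to a different square one level lower.\<close>

lemma connected_scaled_square_K:
  assumes "quadrant Q" "P \<in> components (pre Q k)"
  shows "connected ((\<lambda>z. of_real lam ^ n * z) ` closure P \<inter> K)"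
  using assms
proof (induction n arbitrary: Q P k)
  case 0
  then show ?case using connected_closure_square_K by simp
next
  case (Suc m)
  obtain Q j where Q: "quadrant Q" and P: "P \<in> components (pre Q (Suc j))"
    using square_level_Suc[OF Suc.prems] by blast
  \<comment> \<open>\<open>c\<close> rescales \<open>P\<close>, while \<open>e\<close> and
    \<open>d\<close> are the two scalings in the iterated equation of order \<open>N\<close>. The
    quotient \<open>c / e\<close> is \<open>lam\<close>, so on \<open>c P\<close> the iterate
    becomes \<open>d\<close> times \<open>G\<close>.\<close>
  define c where "c = complex_of_real lam ^ Suc m"
  define e where "e = complex_of_real lam ^ m"
  define d where "d = (- complex_of_real lam) ^ m"
  define N :: nat where "N = 2 ^ m"
  have nz: "c \<noteq> 0" "e \<noteq> 0" "d \<noteq> 0" using lam by (auto simp: c_def d_def e_def)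
  have dR: "d \<in> \<real>" by (simp add: d_def)
  have ce: "c * v / e = of_real lam * v" for v using nz by (simp add: c_def e_def)
  have iter: "z / e \<in> What" "fhat (z / e) = (f ^^ N) z / d" if "z \<in> orbit_dom N" for z
    using scaled_orbit_dom_What[of z m] fhat_scaled[of z m] that by (auto simp: e_def d_def N_def)
  have KD: "z \<in> orbit_dom N" if "z \<in> K" for z using K_eq that by blast
  have KV: "K \<subseteq> V" using K_W W_subset_V by blast
  have Psub: "of_real lam * v \<in> What" "fhat (of_real lam * v) \<in> pre Q j" if "v \<in> P" for v
    using in_components_subset[OF P] that by auto
  show ?case
  proof (cases "(\<lambda>z. c * z) ` closure P \<inter> K = {}")
    case True
    then show ?thesis by (simp add: c_def)
  next
    case False
    then obtain v where v: "v \<in> closure P" "c * v \<in> orbit_dom N" using KD by blast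
    have "open ((\<lambda>v. c * v) -` orbit_dom N)"
      using open_orbit_dom by (intro open_vimage continuous_intros)
    then have "(\<lambda>v. c * v) -` orbit_dom N \<inter> P \<noteq> {}"
      using v open_Int_closure_eq_empty by blast
    then obtain p where p: "p \<in> P" "c * p \<in> orbit_dom N" by blast
    have cont: "continuous_on What fhat" using fhat_holo by (rule holomorphic_on_imp_continuous_on)
    define G where "G v = fhat (of_real lam * v)" for v
    have GP: "connected (G ` P)"
      unfolding G_def using in_components_connected[OF P] Psub(1)
      by (intro connected_continuous_image continuous_on_compose2[OF cont] continuous_intros) auto
    have "G p \<in> pre Q j" using Psub p(1) by (simp add: G_def)
    then obtain P' where P': "P' \<in> components (pre Q j)" "G p \<in> P'"
      using Union_components by (metis UnionE)
    have GP': "G v \<in> P'" if "v \<in> P" for v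
    proof -
      have "G ` P \<subseteq> P'"
        using P' p(1) Psub(2) by (intro components_maximal[OF P'(1) GP]) (auto simp: G_def)
      then show ?thesis using that by blast
    qed
    have iterG: "(f ^^ N) (c * v) = d * G v" if "c * v \<in> orbit_dom N" for v
      using iter(2)[OF that] nz ce by (simp add: G_def field_simps)
    have P'pre: "P' \<subseteq> pre Q j" using in_components_subset[OF P'(1)] .
    have nonreal: "(\<lambda>u. d * u) ` P' \<inter> \<real> = {}"
    proof -
      have "d * u \<notin> \<real>" if "u \<in> P'" for u
      proof
        assume "d * u \<in> \<real>"
        then have "d * u / d \<in> \<real>" using dR by (rule Reals_divide)
        then show False using pre_nonreal[OF Q, of u j] P'pre that nz(3) by auto
      qed
      then show ?thesis by blast
    qed
    have mem: "d * G p \<in> (\<lambda>u. d * u) ` P'" using P'(2) by blast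
    have "(f ^^ N) (c * p) \<notin> \<real>" using nonreal mem iterG[OF p(2)] by auto
    then obtain s \<phi> where b: "branch N s \<phi>" "0 < s * Im (d * G p)" "\<phi> (d * G p) = c * p"
      using branchE[OF p(2)] iterG[OF p(2)] by metis
    have conn: "connected ((\<lambda>u. d * u) ` P')"
      using in_components_connected[OF P'(1)] by (intro connected_continuous_image continuous_intros)
    have pos: "0 < s * Im (d * u)" if "u \<in> P'" for u
      using connected_nonreal_halfplane[OF conn nonreal mem b(2)] that by blast
    \<comment> \<open>The connected set \<open>d P'\<close> misses the real line, so all of it lies
      in the half-plane of the branch at \<open>c * p\<close>.\<close>
    have slit: "d * u \<in> slit_halfplane s" if "u \<in> P'" for u
      using pos[OF that] open_halfplane_slit by blast
    have inv: "\<phi> w \<in> orbit_dom N \<and> (f ^^ N) (\<phi> w) = w" if "w \<in> slit_halfplane s" for w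
      using b(1) that by (auto simp: branch_def)
    have \<phi>cont: "continuous_on (slit_halfplane s) \<phi>" using b(1) by (simp add: branch_def)

    \<comment> \<open>The branch lifts \<open>d P'\<close> to a connected set that, divided by
      \<open>c\<close>, lies in \<open>pre Q (Suc j)\<close> and contains \<open>p\<close>.\<close>
    have step1: "\<phi> (d * u) / c \<in> P" if "u \<in> P'" for u
    proof -
      let ?Y = "(\<lambda>u. \<phi> (d * u) / c) ` P'"
      have "connected ?Y"
        using in_components_connected[OF P'(1)] slit nz(1)
        by (intro connected_continuous_image continuous_on_divide continuous_on_compose2[OF \<phi>cont] continuous_intros) auto
      moreover have "?Y \<subseteq> pre Q (Suc j)"
      proof
        fix v assume "v \<in> ?Y"
        then obtain u where u: "u \<in> P'" "v = \<phi> (d * u) / c" by blast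
        have *: "of_real lam * v = \<phi> (d * u) / e" using ce[of v] nz u(2) by simp
        have D: "\<phi> (d * u) \<in> orbit_dom N" "(f ^^ N) (\<phi> (d * u)) = d * u" using inv[OF slit[OF u(1)]] by auto
        have "of_real lam * v \<in> What" "fhat (of_real lam * v) = u"
          unfolding * using iter[OF D(1)] D(2) nz by auto
        then show "v \<in> pre Q (Suc j)" using u(1) P'pre by auto
      qed
      moreover have "p \<in> ?Y" using P'(2) b(3) nz by (intro image_eqI[of _ _ "G p"]) auto
      ultimately have "?Y \<subseteq> P" using components_maximal[OF P] p(1) by blast
      then show ?thesis using that by blast
    qed

    \<comment> \<open>In the other direction, if values of \<phi> tend to \<open>c * v\<close> with
      \<open>v \<in> P\<close>, continuity of \<open>fhat\<close> at \<open>lam * v\<close> makes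
      their arguments tend to \<open>d * G v\<close>, which is interior to the half-plane.\<close>
    have step2: "(\<lambda>v. c * v) ` P \<subseteq> \<phi> ` {w. 0 < s * Im w}"
    proof (rule branch_absorbs[OF b(1)])
      show "connected ((\<lambda>v. c * v) ` P)"
        using in_components_connected[OF P] by (intro connected_continuous_image continuous_intros)
      show "c * p \<in> (\<lambda>v. c * v) ` P" using p(1) by blast
      show "c * p \<in> \<phi> ` {w. 0 < s * Im w}" using b(2,3) by (metis image_eqI mem_Collect_eq)
      fix w x assume w: "\<And>n. 0 < s * Im (w n)" "(\<lambda>n. \<phi> (w n)) \<longlonglongrightarrow> x" "x \<in> (\<lambda>v. c * v) ` P"
      obtain v where v: "v \<in> P" "x = c * v" using w(3) by blast
      have ws: "w n \<in> slit_halfplane s" for n using w(1) open_halfplane_slit by blast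
      have xe: "x / e \<in> What" using v ce Psub(1) by simp
      have "(\<lambda>n. \<phi> (w n) / e) \<longlonglongrightarrow> x / e" using nz by (intro tendsto_divide w(2) tendsto_const)
      then have "(\<lambda>n. fhat (\<phi> (w n) / e)) \<longlonglongrightarrow> fhat (x / e)"
        by (rule continuous_on_tendsto_compose[OF cont _ xe]) (use iter(1) inv[OF ws] in auto)
      moreover have "fhat (\<phi> (w n) / e) = w n / d" for n using iter(2) inv[OF ws] by auto
      moreover have "fhat (x / e) = G v" using v(2) ce by (simp add: G_def)
      ultimately have "(\<lambda>n. d * (w n / d)) \<longlonglongrightarrow> d * G v" by (intro tendsto_mult tendsto_const) simp
      then have wl: "w \<longlonglongrightarrow> d * G v" using nz by simp
      have Gs: "0 < s * Im (d * G v)" using pos GP' v(1) by blast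
      have "x = \<phi> (d * G v)"
        using LIMSEQ_unique[OF w(2) branch_tendsto(2)[OF b(1) ws wl halfplane_subset_V[OF Gs]]] .
      then show "x \<in> \<phi> ` {w. 0 < s * Im w}" using Gs by blast
    qed

    let ?R = "(\<lambda>u. d * u) ` closure P' \<inter> K"
    have Rslit: "w \<in> slit_halfplane s" if "w \<in> ?R" for w
    proof -
      obtain u where u: "u \<in> closure P'" "w = d * u" using \<open>w \<in> ?R\<close> by blast
      obtain t where t: "\<And>n. t n \<in> P'" "t \<longlonglongrightarrow> u" using u(1) closure_sequential by metis
      have "(\<lambda>n. d * t n) \<longlonglongrightarrow> w" unfolding u(2) by (intro tendsto_mult tendsto_const t(2))
      from branch_tendsto(1)[OF b(1) _ this] show ?thesis using slit t(1) \<open>w \<in> ?R\<close> KV by blast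
    qed
    \<comment> \<open>Sequences in \<open>P\<close> and \<open>P'\<close> carry the two inclusions
      to the closures; since \<open>K\<close> lies in \<open>V\<close>, the limits inside
      \<open>K\<close> avoid the slits and \<phi> is continuous there.\<close>
    have eq: "(\<lambda>z. c * z) ` closure P \<inter> K = \<phi> ` ?R"
    proof (intro set_eqI iffI)
      fix z assume z: "z \<in> (\<lambda>z. c * z) ` closure P \<inter> K"
      then obtain v where v: "v \<in> closure P" "z = c * v" by blast
      obtain t where t: "\<And>n. t n \<in> P" "t \<longlonglongrightarrow> v" using v(1) closure_sequential by metis
      have ct: "(\<lambda>n. c * t n) \<longlonglongrightarrow> z" unfolding v(2) by (intro tendsto_mult tendsto_const t(2))
      have tT: "c * t n \<in> orbit_dom N" "(f ^^ N) (c * t n) \<in> slit_halfplane s"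
        "\<phi> ((f ^^ N) (c * t n)) = c * t n" for n
      proof -
        obtain w where "0 < s * Im w" "c * t n = \<phi> w" using step2 t(1)[of n] by blast
        then show "c * t n \<in> orbit_dom N" "(f ^^ N) (c * t n) \<in> slit_halfplane s"
          "\<phi> ((f ^^ N) (c * t n)) = c * t n" using inv open_halfplane_slit by auto
      qed
      define w where "w = (f ^^ N) z"
      have zD: "z \<in> orbit_dom N" using z KD by blast
      have wK: "w \<in> K" using K_funpow[OF zD] z by (simp add: w_def)
      have lim: "(\<lambda>n. (f ^^ N) (c * t n)) \<longlonglongrightarrow> w"
        unfolding w_def
        using continuous_on_tendsto_compose[OF holomorphic_on_imp_continuous_on[OF funpow_holo] ct zD] tT(1)
        by simp
      have "(\<lambda>n. d * G (t n) / d) \<longlonglongrightarrow> w / d"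
        using lim iterG tT(1) nz by (intro tendsto_divide tendsto_const) auto
      then have "(\<lambda>n. G (t n)) \<longlonglongrightarrow> w / d" using nz by simp
      then have "w / d \<in> closure P'" by (rule closure_limit) (use GP' t(1) in blast)
      then have wR: "w \<in> ?R" using wK nz by (auto intro!: image_eqI[of _ _ "w / d"])
      have "(\<lambda>n. \<phi> ((f ^^ N) (c * t n))) \<longlonglongrightarrow> \<phi> w"
        using branch_tendsto(2)[OF b(1) tT(2) lim] wK KV by blast
      then have "\<phi> w = z" using LIMSEQ_unique[OF _ ct] tT(3) by simp
      then show "z \<in> \<phi> ` ?R" using wR by blast
    next
      fix z assume "z \<in> \<phi> ` ?R"
      then obtain w where w: "w \<in> ?R" "z = \<phi> w" by blast
      then obtain u where u: "u \<in> closure P'" "w = d * u" by blast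
      obtain t where t: "\<And>n. t n \<in> P'" "t \<longlonglongrightarrow> u" using u(1) closure_sequential by metis
      have "(\<lambda>n. d * t n) \<longlonglongrightarrow> w" unfolding u(2) by (intro tendsto_mult tendsto_const t(2))
      from branch_tendsto(2)[OF b(1) _ this]
      have "(\<lambda>n. \<phi> (d * t n)) \<longlonglongrightarrow> z" using slit t(1) w KV by blast
      then have "(\<lambda>n. \<phi> (d * t n) / c) \<longlonglongrightarrow> z / c" using nz by (intro tendsto_divide tendsto_const)
      then have "z / c \<in> closure P" by (rule closure_limit) (use step1 t(1) in blast)
      moreover have "z \<in> K" using K_funpow[of z N] inv[OF Rslit[OF w(1)]] w by auto
      ultimately show "z \<in> (\<lambda>z. c * z) ` closure P \<inter> K"
        using nz by (auto intro!: image_eqI[of _ _ "z / c"])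
    qed
    have R: "connected ?R"
    proof (cases "even m")
      case True
      then have "d = of_real lam ^ m" by (simp add: d_def)
      then show ?thesis using Suc.IH[OF Q P'(1)] by simp
    next
      case False
      \<comment> \<open>For odd \<open>m\<close> the scaling is negative; the symmetry
        \<open>K = -K\<close> reduces it to the induction hypothesis.\<close>
      then have d: "d = - (of_real lam ^ m)" by (simp add: d_def)
      have "?R = uminus ` ((\<lambda>z. of_real lam ^ m * z) ` closure P' \<inter> K)"
      proof (intro set_eqI iffI)
        fix w assume "w \<in> ?R"
        then have "- w \<in> (\<lambda>z. of_real lam ^ m * z) ` closure P' \<inter> K" using d K_minus by auto
        then show "w \<in> uminus ` ((\<lambda>z. of_real lam ^ m * z) ` closure P' \<inter> K)"
          by (intro image_eqI[of _ _ "- w"]) auto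
      next
        fix w assume "w \<in> uminus ` ((\<lambda>z. of_real lam ^ m * z) ` closure P' \<inter> K)"
        then show "w \<in> ?R" using d K_minus by auto
      qed
      then show ?thesis
        using Suc.IH[OF Q P'(1)] by (simp add: connected_continuous_image continuous_on_minus)
    qed
    have "continuous_on ?R \<phi>" using continuous_on_subset[OF \<phi>cont] Rslit by blast
    then have "connected ((\<lambda>z. c * z) ` closure P \<inter> K)"
      unfolding eq using R by (rule connected_continuous_image)
    then show ?thesis by (simp add: c_def)
  qed
qed

end

theorem lemma4:
  fixes l n :: nat and g :: "real \<Rightarrow> real" and lam :: real
    and F Finv f fhat :: "complex \<Rightarrow> complex" and What P :: "complex set"
  assumes "even l" and "2 \<le> l"
    and "period_doubling_fixed_point l g"
    and "feigenbaum_extension l g lam F Finv f"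
    and "polynomial_like l f (dom_W l lam Finv) (slit_plane lam)"
    and "maximal_analytic_extension f (dom_W l lam Finv) fhat What"
    and "simply_connected What"
    and "chess_square l lam Finv fhat What P"
  shows "connected ((\<lambda>z. complex_of_real (lam ^ n) * z) ` closure P
                    \<inter> filled_julia f (dom_W l lam Finv))"
proof -
  interpret feigenbaum_map l g lam F Finv f fhat What
    by unfold_locales (use assms in auto)
  obtain Q k where "quadrant Q" "P \<in> components (iter_preimage lam fhat What k Q)"
    using assms(8) unfolding chess_square_def quadrant_def by blast
  from connected_scaled_square_K[OF this, of n] show ?thesis by simp
qed

end
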